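(* For every integer $n\ge 3$ there exists a non-equivariant embedded Gromov torus of dimension $n$. That is, there exist an integer $N$, a lattice $\Lambda\subset\mathbb{R}^n$ of rank $n$, and a smooth embedding $f:\mathbb{R}^n/\Lambda\to\mathbb{S}^{N-1}\subset\mathbb{R}^N$ into the unit sphere, isometric with respect to the flat metric on $\mathbb{R}^n/\Lambda$, such that all normal curvatures of $f$ as an immersion into $\mathbb{R}^N$ are at most $\sqrt{\frac{3n}{n+2}}$ in all directions at every point, and such that the torus is not equivariant.
   Context: A Gromov torus of dimension $n$ is a smooth immersion of a topological torus $\mathbb{T}^n$ into the closed unit ball of a Euclidean space such that, with respect to the induced metric, all its normal curvatures are at most $\sqrt{\frac{3n}{n+2}}$ in all directions at every point. Here the normal curvature at $x$ in the direction of a unit tangent vector $v$ is $\mathrm{II}_x(v,v)=\gamma_v''(0)$ (second derivative in the Euclidean space), where $\gamma_v$ is the geodesic of the immersed manifold with $\gamma_v(0)=x$, $\gamma_v'(0)=v$, and "at most $c$" means $|\mathrm{II}_x(v,v)|\le c$. Every Gromov torus lies in the unit sphere and has flat induced metric, so it is given by an isometric immersion $f:\mathbb{R}^n/\Lambda\to\mathbb{S}^{N-1}\subset\mathbb{R}^N$ of a flat torus. An embedded Gromov torus is equivariant if its translation group extends to the isometry group of the sphere: there is a group homomorphism $\varphi:\mathbb{R}^n/\Lambda\to O(N)$ with $f(x+a)=\varphi(a)f(x)$ for all $x,a\in\mathbb{R}^n/\Lambda$. *)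

theory Defs
  imports "HOL-Analysis.Analysis"
begin

text \<open>
  \<open>\<real>\<^sup>N\<close> is \<^const>\<open>Euclidean_space\<close> \<open>N\<close>, i.e. sequences \<open>nat \<Rightarrow> real\<close> vanishing from
  index \<open>N\<close> on; thus \<^const>\<open>nsphere\<close> \<open>(N - 1)\<close> is the unit sphere in \<open>\<real>\<^sup>N\<close> when \<open>N \<ge> 1\<close>.
  A map out of the torus \<open>\<real>\<^sup>n/\<Lambda>\<close> is given by its \<open>\<Lambda>\<close>-periodic lift to \<open>\<real>\<^sup>n\<close>, and curves in
  the torus by their lifts to \<open>\<real>\<^sup>n\<close>.
\<close>

definition full_lattice :: "(real ^ 'n) set \<Rightarrow> bool" where
  "full_lattice \<Lambda> \<longleftrightarrow>
    (\<exists>b :: 'n \<Rightarrow> real ^ 'n. inj b \<and> independent (range b) \<and>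
       \<Lambda> = {\<Sum>i\<in>UNIV. of_int (k i) *\<^sub>R b i | k :: 'n \<Rightarrow> int. True})"

primrec Ck :: "nat \<Rightarrow> ('a::euclidean_space \<Rightarrow> 'b::real_normed_vector) \<Rightarrow> bool" where
  "Ck 0 g \<longleftrightarrow> continuous_on UNIV g"
| "Ck (Suc k) g \<longleftrightarrow>
     (\<forall>x. g differentiable (at x)) \<and> (\<forall>v. Ck k (\<lambda>x. frechet_derivative g (at x) v))"

definition smooth :: "('a::euclidean_space \<Rightarrow> 'b::real_normed_vector) \<Rightarrow> bool" where
  "smooth g \<longleftrightarrow> (\<forall>k. Ck k g)"

definition smooth_map :: "nat \<Rightarrow> (real ^ 'n \<Rightarrow> nat \<Rightarrow> real) \<Rightarrow> bool" where
  "smooth_map N f \<longleftrightarrow>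
     range f \<subseteq> topspace (Euclidean_space N) \<and> (\<forall>i<N. smooth (\<lambda>x. f x i))"

definition differential :: "(real ^ 'n \<Rightarrow> nat \<Rightarrow> real) \<Rightarrow> real ^ 'n \<Rightarrow> real ^ 'n \<Rightarrow> nat \<Rightarrow> real" where
  "differential f x v = (\<lambda>i. frechet_derivative (\<lambda>y. f y i) (at x) v)"

definition immersion :: "nat \<Rightarrow> (real ^ 'n \<Rightarrow> nat \<Rightarrow> real) \<Rightarrow> bool" where
  "immersion N f \<longleftrightarrow> smooth_map N f \<and> (\<forall>x. inj (differential f x))"

text \<open>
  An immersion of \<open>\<real>\<^sup>n/\<Lambda>\<close> that is a homeomorphism onto its image: the fibres of the lift are
  exactly the cosets of \<open>\<Lambda>\<close>, and its image carries the quotient topology.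
\<close>

definition smooth_torus_embedding ::
    "nat \<Rightarrow> (real ^ 'n) set \<Rightarrow> (real ^ 'n \<Rightarrow> nat \<Rightarrow> real) \<Rightarrow> bool" where
  "smooth_torus_embedding N \<Lambda> f \<longleftrightarrow>
     immersion N f \<and>
     (\<forall>x y. f x = f y \<longleftrightarrow> x - y \<in> \<Lambda>) \<and>
     quotient_map euclidean (subtopology (Euclidean_space N) (range f)) f"

definition flat_isometric :: "nat \<Rightarrow> (real ^ 'n \<Rightarrow> nat \<Rightarrow> real) \<Rightarrow> bool" where
  "flat_isometric N f \<longleftrightarrow>
     (\<forall>x v w. (\<Sum>i<N. differential f x v i * differential f x w i) = v \<bullet> w)"

definition acceleration ::
    "(real ^ 'n \<Rightarrow> nat \<Rightarrow> real) \<Rightarrow> (real \<Rightarrow> real ^ 'n) \<Rightarrow> real \<Rightarrow> nat \<Rightarrow> real" where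
  "acceleration f c t = (\<lambda>i. deriv (deriv (\<lambda>s. f (c s) i)) t)"

text \<open>
  The Levi-Civita connection of the induced metric is the tangential part of the derivative in
  \<open>\<real>\<^sup>N\<close>, so a curve is a geodesic iff its acceleration is normal to the immersed manifold.
\<close>

definition geodesic ::
    "nat \<Rightarrow> (real ^ 'n \<Rightarrow> nat \<Rightarrow> real) \<Rightarrow> (real \<Rightarrow> real ^ 'n) \<Rightarrow> bool" where
  "geodesic N f c \<longleftrightarrow>
     smooth c \<and>
     (\<forall>t w. (\<Sum>i<N. acceleration f c t i * differential f (c t) w i) = 0)"

text \<open>
  The value \<open>II\<^sub>x(v,v)\<close> in \<open>\<real>\<^sup>N\<close>. It is only meaningful where the geodesic through \<open>x\<close> with
  velocity \<open>v\<close> exists for all times, as it always does on a (compact) torus.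
\<close>

definition normal_curvature ::
    "nat \<Rightarrow> (real ^ 'n \<Rightarrow> nat \<Rightarrow> real) \<Rightarrow> real ^ 'n \<Rightarrow> real ^ 'n \<Rightarrow> nat \<Rightarrow> real" where
  "normal_curvature N f x v =
     (THE a. \<exists>c. geodesic N f c \<and> c 0 = x \<and> (c has_vector_derivative v) (at 0) \<and>
                 a = acceleration f c 0)"

definition normal_curvatures_at_most ::
    "nat \<Rightarrow> (real ^ 'n \<Rightarrow> nat \<Rightarrow> real) \<Rightarrow> real \<Rightarrow> bool" where
  "normal_curvatures_at_most N f C \<longleftrightarrow>
     (\<forall>x v. L2_set (differential f x v) {..<N} = 1 \<longrightarrow>
            L2_set (normal_curvature N f x v) {..<N} \<le> C)"

text \<open>\<open>N \<times> N\<close> matrices are functions \<open>nat \<Rightarrow> nat \<Rightarrow> real\<close> vanishing outside \<open>{..<N} \<times> {..<N}\<close>.\<close>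

definition orthogonal_group :: "nat \<Rightarrow> (nat \<Rightarrow> nat \<Rightarrow> real) set" where
  "orthogonal_group N =
     {A. (\<forall>i j. i \<ge> N \<or> j \<ge> N \<longrightarrow> A i j = 0) \<and>
         (\<forall>i<N. \<forall>j<N. (\<Sum>k<N. A k i * A k j) = (if i = j then 1 else 0))}"

definition mmult ::
    "nat \<Rightarrow> (nat \<Rightarrow> nat \<Rightarrow> real) \<Rightarrow> (nat \<Rightarrow> nat \<Rightarrow> real) \<Rightarrow> nat \<Rightarrow> nat \<Rightarrow> real" where
  "mmult N A B = (\<lambda>i j. \<Sum>k<N. A i k * B k j)"

definition mapply :: "nat \<Rightarrow> (nat \<Rightarrow> nat \<Rightarrow> real) \<Rightarrow> (nat \<Rightarrow> real) \<Rightarrow> nat \<Rightarrow> real" where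
  "mapply N A x = (\<lambda>i. \<Sum>j<N. A i j * x j)"

text \<open>A homomorphism \<open>\<real>\<^sup>n/\<Lambda> \<rightarrow> O(N)\<close>, not required to be continuous, given by its lift to \<open>\<real>\<^sup>n\<close>.\<close>

definition torus_hom ::
    "nat \<Rightarrow> (real ^ 'n) set \<Rightarrow> (real ^ 'n \<Rightarrow> nat \<Rightarrow> nat \<Rightarrow> real) \<Rightarrow> bool" where
  "torus_hom N \<Lambda> \<phi> \<longleftrightarrow>
     range \<phi> \<subseteq> orthogonal_group N \<and>
     (\<forall>a b. \<phi> (a + b) = mmult N (\<phi> a) (\<phi> b)) \<and>
     (\<forall>a. \<forall>l\<in>\<Lambda>. \<phi> (a + l) = \<phi> a)"

definition equivariant ::
    "nat \<Rightarrow> (real ^ 'n) set \<Rightarrow> (real ^ 'n \<Rightarrow> nat \<Rightarrow> real) \<Rightarrow> bool" where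
  "equivariant N \<Lambda> f \<longleftrightarrow>
     (\<exists>\<phi>. torus_hom N \<Lambda> \<phi> \<and> (\<forall>x a. f (x + a) = mapply N (\<phi> a) (f x)))"

end

theory Submission
  imports Defs
begin

text \<open>
  A map with components \<open>\<surd>a e\<^sup>i\<^sup>u\<^sup>x\<close>, for finitely many weights \<open>a\<close> and frequencies \<open>u\<close>, is equivariant. It
  takes values in the unit sphere, is isometric and has normal curvature \<open>\<surd>(3n/(n+2))\<close> in every
  direction as soon as \<open>\<Sum> a = 1\<close>, \<open>\<Sum> a (u \<bullet> v)\<^sup>2 = \<bar>v\<bar>\<^sup>2\<close> and \<open>\<Sum> a (u \<bullet> v)\<^sup>4 = 3n/(n+2) \<bar>v\<bar>\<^sup>4\<close>, that is, if the
  weighted frequencies form a 4-design on the sphere of radius \<open>\<surd>n\<close>.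

  Equivariance is broken as follows. Suppose that a part of the design consists of pairs \<open>u \<plusminus> m\<close> with
  equal weights, where \<open>u\<close> runs through a weighted set \<open>K\<close>. The corresponding part of the map is
  congruent to one with components \<open>cos (m \<bullet> x) e\<^sup>i\<^sup>u\<^sup>x\<close> and \<open>sin (m \<bullet> x) e\<^sup>i\<^sup>u\<^sup>x\<close>. Now keep the first kind for
  \<open>u\<close> in \<open>K\<close>, but let \<open>u\<close> run through another set \<open>M\<close> in the second kind. The norm, the metric and
  the second fundamental form involve \<open>K\<close> and \<open>M\<close> only through moments of orders 0, 2 and 4; if these
  agree, then \<open>cos\<^sup>2 + sin\<^sup>2 = 1\<close> gives the same values as before. The Gram function, however,
  contains the term \<open>cos (m \<bullet> x) cos (m \<bullet> y) \<Sum>\<^sub>K a cos (u \<bullet> (x - y)) + sin (m \<bullet> x) sin (m \<bullet> y) \<Sum>\<^sub>M a cos (u \<bullet> (x - y))\<close>,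
  which is not a function of \<open>x - y\<close> if the two sums differ, whereas the Gram function of an
  equivariant torus is (lemma \<open>torus_not_equivariant\<close>). Here \<open>K\<close> and \<open>M\<close> lie in a plane orthogonal to
  \<open>m\<close>, which takes three dimensions; they are built from the coordinate vectors and the
  Pythagorean triples \<open>(3, 4, 5)\<close> and \<open>(5, 12, 13)\<close>.

  Rational designs with the required pairs come from an induction over the dimension: a design on an
  equator, its copies on two parallels and the pole combine to a design in one dimension more, for
  suitable weights and a suitable rational height of the parallels (lemmas \<open>design_suspension\<close> and
  \<open>suspension_weights_exist\<close>). Rationality makes the common periods of all waves a lattice
  of full rank. The modulated waves only take a fraction of the weight of \<open>u \<plusminus> m\<close>, so all frequencies
  still occur as plain waves, and these separate the points of the quotient.

  As for the normal curvatures: the second derivative of the map in a constant direction is normal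
  by flatness, so the geodesics are exactly the images of straight lines, and the normal curvature in
  a unit direction is the length of that second derivative.
\<close>

section \<open>Modulated waves\<close>

text \<open>
  The phases only ever take the values \<open>0\<close> and \<open>\<pi>/2\<close>, so that each of the two factors is a cosine
  or a sine; keeping them as parameters gives all four products a single calculus.
\<close>

definition wave :: "real \<Rightarrow> real \<Rightarrow> real \<Rightarrow> 'a::real_inner \<Rightarrow> 'a \<Rightarrow> 'a \<Rightarrow> real" where
  "wave A \<phi> \<psi> m u = (\<lambda>x. A * cos (m \<bullet> x - \<phi>) * cos (u \<bullet> x - \<psi>))"

definition dwave :: "real \<Rightarrow> real \<Rightarrow> real \<Rightarrow> 'a::real_inner \<Rightarrow> 'a \<Rightarrow> 'a \<Rightarrow> 'a \<Rightarrow> real" where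
  "dwave A \<phi> \<psi> m u x v =
     - A * ((m \<bullet> v) * sin (m \<bullet> x - \<phi>) * cos (u \<bullet> x - \<psi>) +
            (u \<bullet> v) * cos (m \<bullet> x - \<phi>) * sin (u \<bullet> x - \<psi>))"

definition ddwave :: "real \<Rightarrow> real \<Rightarrow> real \<Rightarrow> 'a::real_inner \<Rightarrow> 'a \<Rightarrow> 'a \<Rightarrow> 'a \<Rightarrow> real" where
  "ddwave A \<phi> \<psi> m u x v =
     A * (2 * (m \<bullet> v) * (u \<bullet> v) * sin (m \<bullet> x - \<phi>) * sin (u \<bullet> x - \<psi>) -
          ((m \<bullet> v)\<^sup>2 + (u \<bullet> v)\<^sup>2) * cos (m \<bullet> x - \<phi>) * cos (u \<bullet> x - \<psi>))"

lemma has_derivative_wave: "(wave A \<phi> \<psi> m u has_derivative dwave A \<phi> \<psi> m u x) (at x)"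
  unfolding wave_def dwave_def
  by (auto intro!: derivative_eq_intros simp: algebra_simps)

lemma frechet_derivative_wave: "frechet_derivative (wave A \<phi> \<psi> m u) (at x) = dwave A \<phi> \<psi> m u x"
  by (rule frechet_derivative_at [symmetric, OF has_derivative_wave])

text \<open>
  The product-to-sum formula shows the frequencies that are really present in a wave, \<open>u + m\<close> and
  \<open>u - m\<close>: they decide its periods, and they reduce its smoothness to that of sums of cosines.
\<close>

lemma wave_eq_sum:
  "wave A \<phi> \<psi> m u x =
     A / 2 * cos ((u + m) \<bullet> x - (\<phi> + \<psi>)) + A / 2 * cos ((u - m) \<bullet> x - (\<psi> - \<phi>))"
proof -
  have 1: "(u + m) \<bullet> x - (\<phi> + \<psi>) = (m \<bullet> x - \<phi>) + (u \<bullet> x - \<psi>)"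
    by (simp add: inner_left_distrib)
  have 2: "(u - m) \<bullet> x - (\<psi> - \<phi>) = (u \<bullet> x - \<psi>) - (m \<bullet> x - \<phi>)"
    by (simp add: inner_diff_left)
  show ?thesis unfolding 1 2 wave_def cos_add cos_diff by (simp add: algebra_simps)
qed

text \<open>
  Directional derivatives of such sums are again such sums, with phases shifted by \<open>\<pi>/2\<close>; hence the
  induction over the order of differentiability works for all amplitudes and phases at once.
\<close>

lemma Ck_cosine_sum:
  fixes p q :: "'a::euclidean_space"
  shows "Ck k (\<lambda>x. A * cos (p \<bullet> x - \<alpha>) + B * cos (q \<bullet> x - \<beta>))"
proof (induction k arbitrary: A B \<alpha> \<beta>)
  case 0
  show ?case by (auto intro!: continuous_intros)
next
  case (Suc k)
  let ?g = "\<lambda>x. A * cos (p \<bullet> x - \<alpha>) + B * cos (q \<bullet> x - \<beta>)"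
  have der: "(?g has_derivative (\<lambda>v. - A * (p \<bullet> v) * sin (p \<bullet> x - \<alpha>) - B * (q \<bullet> v) * sin (q \<bullet> x - \<beta>))) (at x)" for x
    by (auto intro!: derivative_eq_intros simp: algebra_simps)
  have sinc: "sin t = - cos (t + pi / 2)" for t :: real
    by (simp add: cos_add)
  have "(\<lambda>x. frechet_derivative ?g (at x) v) =
     (\<lambda>x. (A * (p \<bullet> v)) * cos (p \<bullet> x - (\<alpha> - pi / 2)) + (B * (q \<bullet> v)) * cos (q \<bullet> x - (\<beta> - pi / 2)))" for v
    unfolding frechet_derivative_at [OF der, symmetric] sinc by (simp add: algebra_simps)
  moreover have "?g differentiable (at x)" for x
    using der by (rule differentiableI)
  ultimately show ?case
    using Suc by simp
qed

lemma smooth_wave: "smooth (wave A \<phi> \<psi> m (u::'a::euclidean_space))"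
  unfolding smooth_def wave_eq_sum [abs_def] by (simp only: Ck_cosine_sum simp_thms)

text \<open>
  The chain rule along a curve: the acceleration of the composition is the Hessian in the direction of
  the velocity plus the differential of the acceleration of the curve.
\<close>

lemma deriv_deriv_wave_along:
  fixes c :: "real \<Rightarrow> 'a::real_inner"
  assumes c1: "\<And>s. (c has_vector_derivative c' s) (at s)"
    and c2: "(c' has_vector_derivative y) (at t)"
  shows "deriv (deriv (\<lambda>s. wave A \<phi> \<psi> m u (c s))) t =
           ddwave A \<phi> \<psi> m u (c t) (c' t) + dwave A \<phi> \<psi> m u (c t) y"
proof -
  have inn: "((\<lambda>s. k \<bullet> c s) has_real_derivative k \<bullet> c' s) (at s)" for k s
    using bounded_linear.has_vector_derivative [OF bounded_linear_inner_right [of k] c1 [of s]]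
    by (simp add: has_real_derivative_iff_has_vector_derivative)
  have inn': "((\<lambda>s. k \<bullet> c' s) has_real_derivative k \<bullet> y) (at t)" for k
    using bounded_linear.has_vector_derivative [OF bounded_linear_inner_right [of k] c2]
    by (simp add: has_real_derivative_iff_has_vector_derivative)
  have "((\<lambda>s. wave A \<phi> \<psi> m u (c s)) has_real_derivative dwave A \<phi> \<psi> m u (c s) (c' s)) (at s)" for s
    unfolding wave_def dwave_def
    by (auto intro!: derivative_eq_intros inn simp: algebra_simps)
  then have 1: "deriv (\<lambda>s. wave A \<phi> \<psi> m u (c s)) = (\<lambda>s. dwave A \<phi> \<psi> m u (c s) (c' s))"
    by (simp add: DERIV_imp_deriv fun_eq_iff)
  have "((\<lambda>s. dwave A \<phi> \<psi> m u (c s) (c' s)) has_real_derivative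
          ddwave A \<phi> \<psi> m u (c t) (c' t) + dwave A \<phi> \<psi> m u (c t) y) (at t)"
    unfolding ddwave_def dwave_def
    by (auto intro!: derivative_eq_intros inn inn' simp: algebra_simps power2_eq_square)
  then show ?thesis
    unfolding 1 by (rule DERIV_imp_deriv)
qed

lemma smooth_curve_derivatives:
  fixes c :: "real \<Rightarrow> 'a::euclidean_space"
  assumes "smooth c"
  obtains c' c'' where "\<And>s. (c has_vector_derivative c' s) (at s)"
    "\<And>s. (c' has_vector_derivative c'' s) (at s)"
proof -
  have vd: "(g has_vector_derivative frechet_derivative g (at s) 1) (at s)"
    if "g differentiable (at s)" for g :: "real \<Rightarrow> 'a" and s
  proof -
    have "(g has_vector_derivative vector_derivative g (at s)) (at s)"
      using that by (simp add: vector_derivative_works)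
    then have "vector_derivative g (at s) = frechet_derivative g (at s) 1"
      unfolding has_vector_derivative_def
      by (metis frechet_derivative_at scaleR_one)
    then show ?thesis using that by (simp add: vector_derivative_works)
  qed
  have "Ck (Suc (Suc 0)) c"
    using assms by (simp only: smooth_def)
  then have "\<And>s. c differentiable (at s)" "\<And>s. (\<lambda>x. frechet_derivative c (at x) 1) differentiable (at s)"
    by simp_all
  then show ?thesis by (intro that) (rule vd, assumption)+
qed

lemma smooth_line: "smooth (\<lambda>t::real. x + t *\<^sub>R (v::'a::euclidean_space))"
proof -
  have const: "Ck k (\<lambda>t::real. w::'a)" for k w
    by (induction k arbitrary: w) (auto simp: frechet_derivative_const)
  have der: "((\<lambda>t::real. x + t *\<^sub>R v) has_derivative (\<lambda>h. h *\<^sub>R v)) (at t)" for t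
    by (auto intro!: derivative_eq_intros)
  have "Ck k (\<lambda>t::real. x + t *\<^sub>R v)" for k
  proof (cases k)
    case 0
    then show ?thesis by (auto intro!: continuous_intros)
  next
    case (Suc j)
    then show ?thesis
      using der by (auto simp: differentiable_def frechet_derivative_at [OF der, symmetric] const)
  qed
  then show ?thesis by (simp add: smooth_def)
qed

section \<open>Finite measures and their moments\<close>

text \<open>
  A list of pairs of a weight and a vector stands for a finite measure, and \<open>wsum\<close> for integration
  against it. Lists allow repeated vectors, so that measures are added by appending.
\<close>

definition wsum :: "(real \<times> 'a) list \<Rightarrow> ('a \<Rightarrow> real) \<Rightarrow> real" where
  "wsum L g = (\<Sum>(a, w)\<leftarrow>L. a * g w)"

lemma wsum_Nil [simp]: "wsum [] g = 0"
  and wsum_Cons [simp]: "wsum ((a, w) # L) g = a * g w + wsum L g"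
  and wsum_append [simp]: "wsum (L @ M) g = wsum L g + wsum M g"
  by (simp_all add: wsum_def)

lemma wsum_add: "wsum L (\<lambda>w. g w + h w) = wsum L g + wsum L h"
  by (induction L) (auto simp: algebra_simps)

lemma wsum_diff: "wsum L (\<lambda>w. g w - h w) = wsum L g - wsum L h"
  by (induction L) (auto simp: algebra_simps)

lemma wsum_cmult: "wsum L (\<lambda>w. c * g w) = c * wsum L g"
  by (induction L) (auto simp: algebra_simps)

definition push :: "real \<Rightarrow> ('a \<Rightarrow> 'b) \<Rightarrow> (real \<times> 'a) list \<Rightarrow> (real \<times> 'b) list" where
  "push r T L = map (\<lambda>(a, w). (r * a, T w)) L"

lemma wsum_push: "wsum (push r T L) g = r * wsum L (\<lambda>w. g (T w))"
  by (induction L) (auto simp: push_def algebra_simps)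

definition mass :: "(real \<times> 'a) list \<Rightarrow> real" where
  "mass L = sum_list (map fst L)"

lemma mass_simps [simp]:
  "mass [] = 0" "mass ((a, w) # L) = a + mass L" "mass (L @ M) = mass L + mass M"
  "mass (push r T L) = r * mass L"
  by (simp_all add: mass_def push_def sum_list_const_mult case_prod_beta comp_def)

lemma wsum_const [simp]: "wsum L (\<lambda>w. c) = c * mass L"
  by (induction L) (auto simp: algebra_simps)

text \<open>
  Equality of all second moments \<open>\<Sum> a (u \<bullet> v)\<^sup>2\<close> thus entails equality of the bilinear ones, which
  are what the metric and the normality of the second derivative involve.
\<close>

lemma second_moment_polarized:
  fixes L :: "(real \<times> 'a::real_inner) list"
  shows "wsum L (\<lambda>u. (u \<bullet> v) * (u \<bullet> w)) =
    (wsum L (\<lambda>u. (u \<bullet> (v + w))\<^sup>2) - wsum L (\<lambda>u. (u \<bullet> v)\<^sup>2) - wsum L (\<lambda>u. (u \<bullet> w)\<^sup>2)) / 2"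
proof -
  have "wsum L (\<lambda>u. (u \<bullet> (v + w))\<^sup>2) =
      wsum L (\<lambda>u. (u \<bullet> v)\<^sup>2) + 2 * wsum L (\<lambda>u. (u \<bullet> v) * (u \<bullet> w)) + wsum L (\<lambda>u. (u \<bullet> w)\<^sup>2)"
    unfolding wsum_cmult [symmetric] wsum_add [symmetric]
    by (simp add: inner_right_distrib power2_sum algebra_simps)
  then show ?thesis by simp
qed

section \<open>Blocks of waves\<close>

text \<open>
  The real and imaginary parts of \<open>x \<mapsto> \<surd>a cos (m \<bullet> x - \<phi>) e\<^sup>i\<^sup>u\<^sup>x\<close> for all entries \<open>(a, u)\<close> of \<open>L\<close>. Summing
  products of derivatives over both parts removes the dependence on \<open>u \<bullet> x\<close>, so that only integrals
  of polynomials in \<open>u\<close> against \<open>L\<close> remain; the four lemmas on blocks below carry this out.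
\<close>

definition block :: "real \<Rightarrow> 'a::real_inner \<Rightarrow> (real \<times> 'a) list \<Rightarrow> ('a \<Rightarrow> real) list" where
  "block \<phi> m L =
     concat (map (\<lambda>(a, u). [wave (sqrt a) \<phi> 0 m u, wave (sqrt a) \<phi> (pi / 2) m u]) L)"

definition hess :: "('a::real_normed_vector \<Rightarrow> real) \<Rightarrow> 'a \<Rightarrow> 'a \<Rightarrow> real" where
  "hess h x v = deriv (deriv (\<lambda>s. h (x + s *\<^sub>R v))) 0"

lemma line_has_vector_derivative: "((\<lambda>t. x + t *\<^sub>R v) has_vector_derivative v) (at s)"
  unfolding has_vector_derivative_def by (auto intro!: derivative_eq_intros)

lemma hess_wave: "hess (wave A \<phi> \<psi> m u) x v = ddwave A \<phi> \<psi> m u x v"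
proof -
  have "hess (wave A \<phi> \<psi> m u) x v =
      ddwave A \<phi> \<psi> m u (x + 0 *\<^sub>R v) v + dwave A \<phi> \<psi> m u (x + 0 *\<^sub>R v) 0"
    unfolding hess_def
    by (rule deriv_deriv_wave_along) (auto intro: line_has_vector_derivative)
  then show ?thesis by (simp add: dwave_def)
qed

lemma sum_list_block:
  "(\<Sum>h\<leftarrow>block \<phi> m L. G h) =
     (\<Sum>(a, u)\<leftarrow>L. G (wave (sqrt a) \<phi> 0 m u) + G (wave (sqrt a) \<phi> (pi / 2) m u))"
  by (induction L) (auto simp: block_def)

lemma sum_list_block_wsum:
  assumes "\<And>a u. (a, u) \<in> set L \<Longrightarrow> a \<ge> 0"
    and "\<And>a u. a \<ge> 0 \<Longrightarrow> G (wave (sqrt a) \<phi> 0 m u) + G (wave (sqrt a) \<phi> (pi / 2) m u) = a * g u"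
  shows "(\<Sum>h\<leftarrow>block \<phi> m L. G h) = wsum L g"
  unfolding sum_list_block wsum_def using assms
  by (intro arg_cong [where f = sum_list] map_cong) auto

lemma cos_sin_quarter_turn [simp]:
  "cos (t - pi / 2) = sin t" "sin (t - pi / 2) = - cos (t::real)"
  by (simp_all add: cos_diff sin_diff)

lemma sin_cos_sq_mult: "sin t * sin t + cos t * cos t = (1::real)"
  using sin_cos_squared_add [of t] by (simp add: power2_eq_square)

lemma block_kernel:
  assumes "\<And>a u. (a, u) \<in> set L \<Longrightarrow> a \<ge> 0"
  shows "(\<Sum>h\<leftarrow>block \<phi> m L. h x * h y) =
    wsum L (\<lambda>u. cos (m \<bullet> x - \<phi>) * cos (m \<bullet> y - \<phi>) * cos (u \<bullet> (x - y)))"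
proof (rule sum_list_block_wsum [OF assms])
  fix a :: real and u assume "a \<ge> 0"
  then have r: "sqrt a * sqrt a = a" by simp
  have algebraic: "r * c * C * (r * c' * C') + r * c * S * (r * c' * S') =
      a * (c * c' * (C * C' + S * S'))" if "r * r = a" for r c c' C C' S S' a :: real
    using that by (simp add: algebra_simps flip: that)
  show "wave (sqrt a) \<phi> 0 m u x * wave (sqrt a) \<phi> 0 m u y +
      wave (sqrt a) \<phi> (pi / 2) m u x * wave (sqrt a) \<phi> (pi / 2) m u y =
      a * (cos (m \<bullet> x - \<phi>) * cos (m \<bullet> y - \<phi>) * cos (u \<bullet> (x - y)))"
    unfolding wave_def inner_diff_right cos_diff [of "u \<bullet> x"] cos_sin_quarter_turn diff_0_right
    by (rule algebraic [OF r])
qed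

lemma block_metric:
  assumes "\<And>a u. (a, u) \<in> set L \<Longrightarrow> a \<ge> 0"
  shows "(\<Sum>h\<leftarrow>block \<phi> m L. frechet_derivative h (at x) v * frechet_derivative h (at x) w) =
    wsum L (\<lambda>u. (m \<bullet> v) * (m \<bullet> w) * (sin (m \<bullet> x - \<phi>))\<^sup>2 +
                (cos (m \<bullet> x - \<phi>))\<^sup>2 * ((u \<bullet> v) * (u \<bullet> w)))"
proof (rule sum_list_block_wsum [OF assms], unfold frechet_derivative_wave)
  fix a :: real and u assume "a \<ge> 0"
  then have r: "sqrt a * sqrt a = a" by simp
  have algebraic: "- r * (p * s * C + q * c * S) * (- r * (p' * s * C + q' * c * S)) +
      - r * (p * s * S + q * c * - C) * (- r * (p' * s * S + q' * c * - C)) =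
      a * (p * p' * s\<^sup>2 + c\<^sup>2 * (q * q'))"
    if "r * r = a" "S * S + C * C = 1" for r a c s C S p p' q q' :: real
  proof -
    have "- r * (p * s * C + q * c * S) * (- r * (p' * s * C + q' * c * S)) +
      - r * (p * s * S + q * c * - C) * (- r * (p' * s * S + q' * c * - C)) = (r * r) * (S * S + C * C) * (p * p' * s\<^sup>2 + c\<^sup>2 * (q * q'))"
      by (simp add: algebra_simps power2_eq_square power4_eq_xxxx)
    then show ?thesis unfolding that by simp
  qed
  show "dwave (sqrt a) \<phi> 0 m u x v * dwave (sqrt a) \<phi> 0 m u x w +
      dwave (sqrt a) \<phi> (pi / 2) m u x v * dwave (sqrt a) \<phi> (pi / 2) m u x w =
      a * ((m \<bullet> v) * (m \<bullet> w) * (sin (m \<bullet> x - \<phi>))\<^sup>2 +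
                (cos (m \<bullet> x - \<phi>))\<^sup>2 * ((u \<bullet> v) * (u \<bullet> w)))"
    unfolding dwave_def cos_sin_quarter_turn diff_0_right
    by (rule algebraic [OF r sin_cos_sq_mult])
qed

lemma block_normality:
  assumes "\<And>a u. (a, u) \<in> set L \<Longrightarrow> a \<ge> 0"
  shows "(\<Sum>h\<leftarrow>block \<phi> m L. hess h x v * frechet_derivative h (at x) w) =
    cos (m \<bullet> x - \<phi>) * sin (m \<bullet> x - \<phi>) *
      ((m \<bullet> w) * (m \<bullet> v)\<^sup>2 * mass L + (m \<bullet> w) * wsum L (\<lambda>u. (u \<bullet> v)\<^sup>2) -
        2 * (m \<bullet> v) * wsum L (\<lambda>u. (u \<bullet> v) * (u \<bullet> w)))"
proof (unfold wsum_cmult [symmetric] wsum_add [symmetric] wsum_diff [symmetric] wsum_const [symmetric],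
    rule sum_list_block_wsum [OF assms], unfold frechet_derivative_wave hess_wave)
  fix a :: real and u assume "a \<ge> 0"
  then have r: "sqrt a * sqrt a = a" by simp
  have algebraic: "r * (2 * p * q * s * S - (p\<^sup>2 + q\<^sup>2) * c * C) * (- r * (p' * s * C + q' * c * S)) +
      r * (2 * p * q * s * - C - (p\<^sup>2 + q\<^sup>2) * c * S) * (- r * (p' * s * S + q' * c * - C)) =
      a * (c * s * (p' * p\<^sup>2 + p' * q\<^sup>2 - 2 * p * (q * q')))"
    if "r * r = a" "S * S + C * C = 1" for r a c s C S p p' q q' :: real
  proof -
    have "r * (2 * p * q * s * S - (p\<^sup>2 + q\<^sup>2) * c * C) * (- r * (p' * s * C + q' * c * S)) +
      r * (2 * p * q * s * - C - (p\<^sup>2 + q\<^sup>2) * c * S) * (- r * (p' * s * S + q' * c * - C)) = (r * r) * (S * S + C * C) * (c * s * (p' * p\<^sup>2 + p' * q\<^sup>2 - 2 * p * (q * q')))"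
      by (simp add: algebra_simps power2_eq_square power4_eq_xxxx)
    then show ?thesis unfolding that by simp
  qed
  show "ddwave (sqrt a) \<phi> 0 m u x v * dwave (sqrt a) \<phi> 0 m u x w +
      ddwave (sqrt a) \<phi> (pi / 2) m u x v * dwave (sqrt a) \<phi> (pi / 2) m u x w =
      a * (cos (m \<bullet> x - \<phi>) * sin (m \<bullet> x - \<phi>) *
      ((m \<bullet> w) * (m \<bullet> v)\<^sup>2 + (m \<bullet> w) * (u \<bullet> v)\<^sup>2 - 2 * (m \<bullet> v) * ((u \<bullet> v) * (u \<bullet> w))))"
    unfolding dwave_def ddwave_def cos_sin_quarter_turn diff_0_right
    by (rule algebraic [OF r sin_cos_sq_mult])
qed

lemma block_curvature:
  assumes "\<And>a u. (a, u) \<in> set L \<Longrightarrow> a \<ge> 0"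
  shows "(\<Sum>h\<leftarrow>block \<phi> m L. (hess h x v)\<^sup>2) =
    wsum L (\<lambda>u. (cos (m \<bullet> x - \<phi>))\<^sup>2 *
        ((m \<bullet> v) ^ 4 + 2 * (m \<bullet> v)\<^sup>2 * (u \<bullet> v)\<^sup>2 + (u \<bullet> v) ^ 4) +
      4 * (m \<bullet> v)\<^sup>2 * (sin (m \<bullet> x - \<phi>))\<^sup>2 * (u \<bullet> v)\<^sup>2)"
proof (rule sum_list_block_wsum [OF assms], unfold hess_wave)
  fix a :: real and u assume "a \<ge> 0"
  then have r: "sqrt a * sqrt a = a" by simp
  have algebraic: "(r * (2 * p * q * s * S - (p\<^sup>2 + q\<^sup>2) * c * C))\<^sup>2 +
      (r * (2 * p * q * s * - C - (p\<^sup>2 + q\<^sup>2) * c * S))\<^sup>2 =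
      a * (c\<^sup>2 * (p ^ 4 + 2 * p\<^sup>2 * q\<^sup>2 + q ^ 4) + 4 * p\<^sup>2 * s\<^sup>2 * q\<^sup>2)"
    if "r * r = a" "S * S + C * C = 1" for r a c s C S p q :: real
  proof -
    have "(r * (2 * p * q * s * S - (p\<^sup>2 + q\<^sup>2) * c * C))\<^sup>2 +
      (r * (2 * p * q * s * - C - (p\<^sup>2 + q\<^sup>2) * c * S))\<^sup>2 = (r * r) * (S * S + C * C) * (c\<^sup>2 * (p ^ 4 + 2 * p\<^sup>2 * q\<^sup>2 + q ^ 4) + 4 * p\<^sup>2 * s\<^sup>2 * q\<^sup>2)"
      by (simp add: algebra_simps power2_eq_square power4_eq_xxxx)
    then show ?thesis unfolding that by simp
  qed
  show "(ddwave (sqrt a) \<phi> 0 m u x v)\<^sup>2 + (ddwave (sqrt a) \<phi> (pi / 2) m u x v)\<^sup>2 =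
      a * ((cos (m \<bullet> x - \<phi>))\<^sup>2 *
        ((m \<bullet> v) ^ 4 + 2 * (m \<bullet> v)\<^sup>2 * (u \<bullet> v)\<^sup>2 + (u \<bullet> v) ^ 4) +
      4 * (m \<bullet> v)\<^sup>2 * (sin (m \<bullet> x - \<phi>))\<^sup>2 * (u \<bullet> v)\<^sup>2)"
    unfolding ddwave_def cos_sin_quarter_turn diff_0_right
    by (rule algebraic [OF r sin_cos_sq_mult])
qed

section \<open>Tori with coupled frequencies\<close>

text \<open>
  The waves of \<open>L\<close> are plain exponentials, those of \<open>K\<close> are modulated by \<open>cos (m \<bullet> x)\<close> and those of
  \<open>M\<close> by \<open>sin (m \<bullet> x)\<close>. If \<open>M\<close> were equal to \<open>K\<close>, the modulated part would consist of plain
  exponentials with frequencies \<open>u \<plusminus> m\<close>. The moments of orders 0, 2 and 4 do not notice the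
  difference between \<open>K\<close> and \<open>M\<close>, and the last three conditions say that the measure formed by \<open>L\<close>
  and by the frequencies \<open>u \<plusminus> m\<close>, each with half the weight of \<open>u\<close> in \<open>K\<close>, has the moments that
  the unit sphere, the flat metric and the constant curvature require.
\<close>

locale coupled_spectrum =
  fixes L K M :: "(real \<times> (real ^ 'n)) list" and m :: "real ^ 'n" and B :: real
  assumes weights_L: "\<And>a u. (a, u) \<in> set L \<Longrightarrow> a > 0"
    and weights_K: "\<And>a u. (a, u) \<in> set K \<Longrightarrow> a \<ge> 0"
    and weights_M: "\<And>a u. (a, u) \<in> set M \<Longrightarrow> a \<ge> 0"
    and moment0: "mass M = mass K"
    and moment2: "\<And>v. wsum M (\<lambda>u. (u \<bullet> v)\<^sup>2) = wsum K (\<lambda>u. (u \<bullet> v)\<^sup>2)"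
    and moment4: "\<And>v. wsum M (\<lambda>u. (u \<bullet> v) ^ 4) = wsum K (\<lambda>u. (u \<bullet> v) ^ 4)"
    and total0: "mass L + mass K = 1"
    and total2: "\<And>v. wsum L (\<lambda>u. (u \<bullet> v)\<^sup>2) + (m \<bullet> v)\<^sup>2 * mass K +
                     wsum K (\<lambda>u. (u \<bullet> v)\<^sup>2) = v \<bullet> v"
    and total4: "\<And>v. wsum L (\<lambda>u. (u \<bullet> v) ^ 4) + (m \<bullet> v) ^ 4 * mass K +
                     6 * (m \<bullet> v)\<^sup>2 * wsum K (\<lambda>u. (u \<bullet> v)\<^sup>2) + wsum K (\<lambda>u. (u \<bullet> v) ^ 4) =
                     B * (v \<bullet> v)\<^sup>2"
begin

definition waves :: "(real ^ 'n \<Rightarrow> real) list" where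
  "waves = block 0 0 L @ block 0 m K @ block (pi / 2) m M"

definition torus :: "real ^ 'n \<Rightarrow> nat \<Rightarrow> real" where
  "torus x = (\<lambda>i. if i < length waves then (waves ! i) x else 0)"

lemma weights_L': "(a, u) \<in> set L \<Longrightarrow> a \<ge> 0"
  using weights_L by force

lemma sum_over_waves: "(\<Sum>i<length waves. G (waves ! i)) = (\<Sum>h\<leftarrow>waves. G h)"
  by (simp add: sum_list_sum_nth atLeast0LessThan)

lemma waves_are_waves:
  assumes "h \<in> set waves" obtains A \<phi> \<psi> k u where "h = wave A \<phi> \<psi> k u"
  using assms unfolding waves_def block_def by auto

text \<open>
  The Gram function of the torus. For an equivariant torus it depends on \<open>x - y\<close> only.
\<close>

lemma kernel_of_torus:
  "(\<Sum>i<length waves. torus x i * torus y i) =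
     wsum L (\<lambda>u. cos (u \<bullet> (x - y))) +
     cos (m \<bullet> x) * cos (m \<bullet> y) * wsum K (\<lambda>u. cos (u \<bullet> (x - y))) +
     sin (m \<bullet> x) * sin (m \<bullet> y) * wsum M (\<lambda>u. cos (u \<bullet> (x - y)))"
proof -
  have "(\<Sum>i<length waves. torus x i * torus y i) = (\<Sum>h\<leftarrow>waves. h x * h y)"
    unfolding sum_over_waves [symmetric] by (simp add: torus_def)
  then show ?thesis
    unfolding waves_def
    by (simp add: block_kernel weights_L' weights_K weights_M wsum_cmult)
qed

lemma unit_length: "(\<Sum>i<length waves. (torus x i)\<^sup>2) = 1"
proof -
  have "(\<Sum>i<length waves. (torus x i)\<^sup>2) =
      mass L + (sin (m \<bullet> x) * sin (m \<bullet> x) + cos (m \<bullet> x) * cos (m \<bullet> x)) * mass K"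
    unfolding distrib_right using kernel_of_torus [of x x] moment0 by (simp add: power2_eq_square)
  then show ?thesis using total0 by (simp add: sin_cos_sq_mult)
qed

lemma torus_nonempty: "length waves \<ge> 1"
  using unit_length [of 0] by (cases "length waves") auto

lemma differential_torus:
  "differential torus x v i = (if i < length waves then frechet_derivative (waves ! i) (at x) v else 0)"
  by (simp add: differential_def torus_def frechet_derivative_const)

lemma moment2_polarized:
  "wsum M (\<lambda>u. (u \<bullet> v) * (u \<bullet> w)) = wsum K (\<lambda>u. (u \<bullet> v) * (u \<bullet> w))"
  by (simp add: second_moment_polarized moment2)

lemma total2_polarized:
  "wsum L (\<lambda>u. (u \<bullet> v) * (u \<bullet> w)) + (m \<bullet> v) * (m \<bullet> w) * mass K +
     wsum K (\<lambda>u. (u \<bullet> v) * (u \<bullet> w)) = v \<bullet> w"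
proof -
  have "(m \<bullet> v) * (m \<bullet> w) = ((m \<bullet> (v + w))\<^sup>2 - (m \<bullet> v)\<^sup>2 - (m \<bullet> w)\<^sup>2) / 2"
    by (simp add: inner_right_distrib power2_sum)
  moreover have "v \<bullet> w = ((v + w) \<bullet> (v + w) - v \<bullet> v - w \<bullet> w) / 2"
    by (simp add: inner_commute algebra_simps)
  ultimately show ?thesis
    unfolding second_moment_polarized using total2 [of "v + w"] total2 [of v] total2 [of w]
    by (simp only:) (simp add: field_simps del: inner_add_left inner_add_right)
qed

lemma torus_flat: "flat_isometric (length waves) torus"
  unfolding flat_isometric_def
proof (intro allI)
  fix x v w
  define s where "s = (sin (m \<bullet> x))\<^sup>2"
  define c where "c = (cos (m \<bullet> x))\<^sup>2"
  have sc: "s + c = 1" by (simp add: s_def c_def)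
  let ?K = "wsum K (\<lambda>u. (u \<bullet> v) * (u \<bullet> w))"
  have "(\<Sum>i<length waves. differential torus x v i * differential torus x w i) =
      (\<Sum>h\<leftarrow>waves. frechet_derivative h (at x) v * frechet_derivative h (at x) w)"
    unfolding sum_over_waves [symmetric] by (simp add: differential_torus)
  also have "\<dots> = wsum L (\<lambda>u. (u \<bullet> v) * (u \<bullet> w)) +
      ((m \<bullet> v) * (m \<bullet> w) * s * mass K + c * ?K) +
      ((m \<bullet> v) * (m \<bullet> w) * c * mass K + s * ?K)"
    unfolding waves_def
    by (simp add: block_metric weights_L' weights_K weights_M wsum_add wsum_cmult moment0
        moment2_polarized s_def c_def)
  also have "\<dots> = wsum L (\<lambda>u. (u \<bullet> v) * (u \<bullet> w)) +
      (s + c) * ((m \<bullet> v) * (m \<bullet> w) * mass K + ?K)"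
    by (simp add: algebra_simps)
  also have "\<dots> = v \<bullet> w"
    using total2_polarized [of v w] sc by simp
  finally show "(\<Sum>i<length waves. differential torus x v i * differential torus x w i) = v \<bullet> w" .
qed

text \<open>
  The contributions of \<open>K\<close> and \<open>M\<close> carry the factors \<open>cos sin\<close> and \<open>- cos sin\<close> of \<open>m \<bullet> x\<close> and
  cancel by equality of the moments of orders 0 and 2; the plain waves contribute nothing.
\<close>

lemma hess_normal: "(\<Sum>h\<leftarrow>waves. hess h x v * frechet_derivative h (at x) w) = 0"
  unfolding waves_def
  by (simp add: block_normality weights_L' weights_K weights_M moment0 moment2 moment2_polarized)

lemma hess_length: "(\<Sum>h\<leftarrow>waves. (hess h x v)\<^sup>2) = B * (v \<bullet> v)\<^sup>2"
proof -
  define s where "s = (sin (m \<bullet> x))\<^sup>2"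
  define c where "c = (cos (m \<bullet> x))\<^sup>2"
  have sc: "s + c = 1" by (simp add: s_def c_def)
  let ?K0 = "mass K" and ?K2 = "wsum K (\<lambda>u. (u \<bullet> v)\<^sup>2)" and ?K4 = "wsum K (\<lambda>u. (u \<bullet> v) ^ 4)"
  have "(\<Sum>h\<leftarrow>waves. (hess h x v)\<^sup>2) = wsum L (\<lambda>u. (u \<bullet> v) ^ 4) +
      (c * ((m \<bullet> v) ^ 4 * ?K0 + 2 * (m \<bullet> v)\<^sup>2 * ?K2 + ?K4) + 4 * (m \<bullet> v)\<^sup>2 * s * ?K2) +
      (s * ((m \<bullet> v) ^ 4 * ?K0 + 2 * (m \<bullet> v)\<^sup>2 * ?K2 + ?K4) + 4 * (m \<bullet> v)\<^sup>2 * c * ?K2)"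
    unfolding waves_def
    by (simp add: block_curvature weights_L' weights_K weights_M wsum_add wsum_cmult moment0
        moment2 moment4 s_def c_def)
  also have "\<dots> = wsum L (\<lambda>u. (u \<bullet> v) ^ 4) +
      (s + c) * ((m \<bullet> v) ^ 4 * ?K0 + 6 * (m \<bullet> v)\<^sup>2 * ?K2 + ?K4)"
    by (simp add: algebra_simps)
  also have "\<dots> = B * (v \<bullet> v)\<^sup>2"
    using total4 [of v] sc by simp
  finally show ?thesis .
qed

lemma acceleration_torus:
  assumes c1: "\<And>s. (c has_vector_derivative c' s) (at s)"
    and c2: "(c' has_vector_derivative y) (at t)"
  shows "acceleration torus c t i =
    (if i < length waves then hess (waves ! i) (c t) (c' t) else 0) + differential torus (c t) y i"
proof (cases "i < length waves")
  case True
  obtain A \<phi> \<psi> m u where "waves ! i = wave A \<phi> \<psi> m u"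
    by (rule waves_are_waves [OF nth_mem [OF True]])
  then show ?thesis
    using True deriv_deriv_wave_along [OF c1 c2]
    by (simp add: acceleration_def torus_def differential_torus hess_wave frechet_derivative_wave)
next
  case False
  then show ?thesis by (simp add: acceleration_def torus_def differential_torus)
qed

lemma differential_torus_zero: "differential torus x 0 i = 0"
proof (cases "i < length waves")
  case True
  obtain A \<phi> \<psi> k u where "waves ! i = wave A \<phi> \<psi> k u"
    by (rule waves_are_waves [OF nth_mem [OF True]])
  then show ?thesis
    by (simp add: differential_torus frechet_derivative_wave dwave_def)
qed (simp add: differential_torus)

text \<open>
  Straight lines are geodesics. Conversely, the acceleration of any geodesic is the Hessian, which is
  normal, plus the differential of \<open>c''\<close>; being normal as well, it forces the differential of \<open>c''\<close> to
  be orthogonal to itself, whence \<open>c'' = 0\<close> by flatness. So the description that defines the normal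
  curvature has exactly one solution.
\<close>

lemma normal_curvature_torus:
  "normal_curvature (length waves) torus x v =
     (\<lambda>i. if i < length waves then hess (waves ! i) x v else 0)"
  unfolding normal_curvature_def
proof (rule the_equality)
  let ?c = "\<lambda>t. x + t *\<^sub>R v"
  have c1: "(?c has_vector_derivative v) (at s)" for s
    by (rule line_has_vector_derivative)
  have acc: "acceleration torus ?c t = (\<lambda>i. if i < length waves then hess (waves ! i) (?c t) v else 0)" for t
  proof
    fix i
    show "acceleration torus ?c t i = (if i < length waves then hess (waves ! i) (?c t) v else 0)"
      using acceleration_torus [of ?c "\<lambda>_. v" 0 t i, OF c1]
      by (simp add: differential_torus_zero)
  qed
  have "geodesic (length waves) torus ?c"
    unfolding geodesic_def
  proof (intro conjI allI)
    show "smooth ?c" by (rule smooth_line)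
    fix t w
    have "(\<Sum>i<length waves. acceleration torus ?c t i * differential torus (?c t) w i) =
        (\<Sum>h\<leftarrow>waves. hess h (?c t) v * frechet_derivative h (at (?c t)) w)"
      unfolding sum_over_waves [symmetric] acc by (simp add: differential_torus)
    then show "(\<Sum>i<length waves. acceleration torus ?c t i * differential torus (?c t) w i) = 0"
      by (simp add: hess_normal)
  qed
  then show "\<exists>c. geodesic (length waves) torus c \<and> c 0 = x \<and> (c has_vector_derivative v) (at 0) \<and>
      (\<lambda>i. if i < length waves then hess (waves ! i) x v else 0) = acceleration torus c 0"
    using c1 acc [of 0] by (intro exI [of _ ?c]) auto
next
  fix a
  assume "\<exists>c. geodesic (length waves) torus c \<and> c 0 = x \<and> (c has_vector_derivative v) (at 0) \<and>
      a = acceleration torus c 0"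
  then obtain c where geo: "geodesic (length waves) torus c" and c0: "c 0 = x"
    and cv: "(c has_vector_derivative v) (at 0)" and a: "a = acceleration torus c 0"
    by blast
  obtain c' c'' where c1: "\<And>s. (c has_vector_derivative c' s) (at s)"
    and c2: "\<And>s. (c' has_vector_derivative c'' s) (at s)"
    using geo smooth_curve_derivatives unfolding geodesic_def by blast
  have c'0: "c' 0 = v"
    using c1 cv by (rule vector_derivative_unique_at)
  have acc: "acceleration torus c 0 i =
      (if i < length waves then hess (waves ! i) x v else 0) + differential torus x (c'' 0) i" for i
    using acceleration_torus [OF c1 c2, of 0 i] c0 c'0 by simp
  have "0 = (\<Sum>i<length waves. acceleration torus c 0 i * differential torus x (c'' 0) i)"
    using geo c0 unfolding geodesic_def by metis
  also have "\<dots> = (\<Sum>h\<leftarrow>waves. hess h x v * frechet_derivative h (at x) (c'' 0)) +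
      (\<Sum>i<length waves. differential torus x (c'' 0) i * differential torus x (c'' 0) i)"
    unfolding sum_over_waves [symmetric] acc
    by (simp add: differential_torus algebra_simps sum.distrib)
  also have "\<dots> = c'' 0 \<bullet> c'' 0"
    using torus_flat by (simp add: flat_isometric_def hess_normal)
  finally have "c'' 0 = 0" by simp
  then have "differential torus x (c'' 0) i = 0" for i
    by (simp add: differential_torus_zero)
  then show "a = (\<lambda>i. if i < length waves then hess (waves ! i) x v else 0)"
    unfolding a using acc by auto
qed

lemma torus_curvature: "normal_curvatures_at_most (length waves) torus (sqrt B)"
  unfolding normal_curvatures_at_most_def
proof (intro allI impI)
  fix x v assume "L2_set (differential torus x v) {..<length waves} = 1"
  then have "(\<Sum>i<length waves. differential torus x v i * differential torus x v i) = 1"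
    by (simp add: L2_set_def power2_eq_square)
  then have "v \<bullet> v = 1"
    using torus_flat by (simp add: flat_isometric_def)
  have "(\<Sum>i<length waves. (normal_curvature (length waves) torus x v i)\<^sup>2) = B"
    using hess_length [of x v] \<open>v \<bullet> v = 1\<close>
    unfolding sum_over_waves [symmetric] normal_curvature_torus by simp
  then show "L2_set (normal_curvature (length waves) torus x v) {..<length waves} \<le> sqrt B"
    by (simp add: L2_set_def)
qed

lemma torus_in_sphere: "range torus \<subseteq> topspace (nsphere (length waves - 1))"
proof -
  have "{..length waves - 1} = {..<length waves}"
    using torus_nonempty by auto
  then show ?thesis
    using unit_length torus_nonempty by (auto simp: nsphere) (auto simp: torus_def)
qed

lemma torus_immersion: "immersion (length waves) torus"
  unfolding immersion_def smooth_map_def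
proof (intro conjI allI impI)
  show "range torus \<subseteq> topspace (Euclidean_space (length waves))"
    by (auto simp: topspace_Euclidean_space torus_def)
  show "smooth (\<lambda>x. torus x i)" if i: "i < length waves" for i
  proof -
    obtain A \<phi> \<psi> k u where "waves ! i = wave A \<phi> \<psi> k u"
      by (rule waves_are_waves [OF nth_mem [OF i]])
    then have "(\<lambda>x. torus x i) = wave A \<phi> \<psi> k u"
      using i by (simp add: torus_def)
    then show ?thesis by (simp only: smooth_wave)
  qed
  show "inj (differential torus x)" for x
  proof (rule injI)
    fix v w assume "differential torus x v = differential torus x w"
    then have "v \<bullet> z = w \<bullet> z" for z
      using torus_flat [unfolded flat_isometric_def, rule_format, of x v z]
        torus_flat [unfolded flat_isometric_def, rule_format, of x w z] by simp
    then show "v = w" by (metis vector_eq_rdot)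
  qed
qed

end

section \<open>Bases of lattices\<close>

lemma subgroup_has_generator:
  fixes G :: "int set"
  assumes "0 \<in> G" and diff: "\<And>x y. x \<in> G \<Longrightarrow> y \<in> G \<Longrightarrow> x - y \<in> G" and "q \<in> G" "q > 0"
  obtains g where "g \<in> G" "g > 0" "\<And>x. x \<in> G \<Longrightarrow> g dvd x"
proof -
  define n where "n = (LEAST n. int n \<in> G \<and> n > 0)"
  have n: "int n \<in> G \<and> n > 0"
    unfolding n_def by (rule LeastI [of _ "nat q"]) (use assms in auto)
  have mult: "int k * int n \<in> G" for k
  proof (induction k)
    case (Suc k)
    then have "int k * int n - (0 - int n) \<in> G" using diff n assms(1) by blast
    then show ?case by (simp add: algebra_simps)
  qed (use assms in simp)
  have mult': "z * int n \<in> G" for z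
  proof (cases "z \<ge> 0")
    case True
    then show ?thesis using mult [of "nat z"] by simp
  next
    case False
    then have "0 - int (nat (- z)) * int n \<in> G" using mult diff assms(1) by blast
    then show ?thesis using False by simp
  qed
  have "int n dvd x" if "x \<in> G" for x
  proof (rule ccontr)
    assume "\<not> int n dvd x"
    then have "x mod int n \<noteq> 0"
      by (simp add: dvd_eq_mod_eq_0)
    moreover have "x mod int n \<ge> 0" "x mod int n < int n"
      using n by simp_all
    ultimately have "x mod int n > 0" "x mod int n < int n"
      by linarith+
    moreover have "x mod int n \<in> G"
      using diff [OF that mult' [of "x div int n"]] by (simp add: minus_div_mult_eq_mod)
    ultimately have "n \<le> nat (x mod int n)"
      unfolding n_def by (intro Least_le) auto
    with \<open>x mod int n < int n\<close> \<open>x mod int n > 0\<close> show False by simp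
  qed
  then show ?thesis using n by (intro that [of "int n"]) auto
qed

text \<open>
  A basis, both over \<open>\<int>\<close> for the part of \<open>\<Lambda>\<close> supported in the coordinates \<open>S\<close> and over \<open>\<real>\<close> for its span.
\<close>

definition basis_within :: "(real ^ 'n) set \<Rightarrow> 'n set \<Rightarrow> ('n \<Rightarrow> real ^ 'n) \<Rightarrow> bool" where
  "basis_within \<Lambda> S b \<longleftrightarrow>
     (\<forall>i\<in>S. b i \<in> \<Lambda>) \<and> (\<forall>i\<in>S. \<forall>j. j \<notin> S \<longrightarrow> b i $ j = 0) \<and>
     (\<forall>x\<in>\<Lambda>. (\<forall>i. i \<notin> S \<longrightarrow> x $ i = 0) \<longrightarrow>
        (\<exists>k::'n \<Rightarrow> int. x = (\<Sum>i\<in>S. of_int (k i) *\<^sub>R b i))) \<and>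
     (\<forall>r :: 'n \<Rightarrow> real. (\<Sum>i\<in>S. r i *\<^sub>R b i) = 0 \<longrightarrow> (\<forall>i\<in>S. r i = 0))"

text \<open>
  A subgroup lying between two multiples of the integer grid has a basis in echelon form: when a
  coordinate \<open>s\<close> is added, the values of that coordinate form a nonzero subgroup of \<open>\<kappa>\<int>\<close>, and a vector
  attaining its generator extends the basis, because subtracting a multiple of it clears the
  coordinate \<open>s\<close>.
\<close>

lemma triangular_basis:
  fixes \<Lambda> :: "(real ^ 'n) set"
  assumes zero: "0 \<in> \<Lambda>" and diff: "\<And>x y. x \<in> \<Lambda> \<Longrightarrow> y \<in> \<Lambda> \<Longrightarrow> x - y \<in> \<Lambda>"
    and "\<kappa> > 0" and grid: "\<And>x i. x \<in> \<Lambda> \<Longrightarrow> \<exists>k::int. x $ i = \<kappa> * of_int k"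
    and "Q > 0" and axes: "\<And>i. axis i (\<kappa> * of_int Q) \<in> \<Lambda>"
  shows "finite S \<Longrightarrow> \<exists>b. basis_within \<Lambda> S b"
proof (induction S rule: finite_induct)
  case empty
  then show ?case by (auto simp: basis_within_def vec_eq_iff)
next
  case (insert s S)
  then obtain b where basis: "basis_within \<Lambda> S b" by blast
  have b: "b i \<in> \<Lambda>" if "i \<in> S" for i
    using basis that unfolding basis_within_def by blast
  have supp: "b i $ j = 0" if "i \<in> S" "j \<notin> S" for i j
    using basis that unfolding basis_within_def by blast
  have gen: "\<exists>k::'n \<Rightarrow> int. x = (\<Sum>i\<in>S. of_int (k i) *\<^sub>R b i)"
    if "x \<in> \<Lambda>" "\<forall>i. i \<notin> S \<longrightarrow> x $ i = 0" for x
    using basis that unfolding basis_within_def by blast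
  have ind: "\<forall>i\<in>S. r i = 0" if "(\<Sum>i\<in>S. r i *\<^sub>R b i) = 0" for r
    using basis that unfolding basis_within_def by blast
  define \<Lambda>' where "\<Lambda>' = {x \<in> \<Lambda>. \<forall>i. i \<notin> insert s S \<longrightarrow> x $ i = 0}"
  define G where "G = {k::int. \<exists>x\<in>\<Lambda>'. x $ s = \<kappa> * of_int k}"
  have diff': "x - y \<in> \<Lambda>'" if "x \<in> \<Lambda>'" "y \<in> \<Lambda>'" for x y
    using that diff by (auto simp: \<Lambda>'_def)
  have "0 \<in> \<Lambda>'" using zero by (auto simp: \<Lambda>'_def)
  have "0 \<in> G" using \<open>0 \<in> \<Lambda>'\<close> by (auto simp: G_def intro!: bexI [of _ 0])
  moreover have "x - y \<in> G" if "x \<in> G" "y \<in> G" for x y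
  proof -
    obtain x' y' where "x' \<in> \<Lambda>'" "x' $ s = \<kappa> * of_int x" "y' \<in> \<Lambda>'" "y' $ s = \<kappa> * of_int y"
      using \<open>x \<in> G\<close> \<open>y \<in> G\<close> by (auto simp: G_def)
    then have "x' - y' \<in> \<Lambda>'" "(x' - y') $ s = \<kappa> * of_int (x - y)"
      using diff' by (auto simp: algebra_simps)
    then show ?thesis unfolding G_def by blast
  qed
  moreover have "Q \<in> G"
    using axes [of s] unfolding G_def \<Lambda>'_def
    by (auto intro!: bexI [of _ "axis s (\<kappa> * of_int Q)"] simp: axis_def)
  ultimately obtain g where g: "g \<in> G" "g > 0" "\<And>x. x \<in> G \<Longrightarrow> g dvd x"
    using \<open>Q > 0\<close> by (rule subgroup_has_generator) auto
  then obtain bs where bs: "bs \<in> \<Lambda>'" "bs $ s = \<kappa> * of_int g" by (auto simp: G_def)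
  define b' where "b' = b(s := bs)"
  have sum': "(\<Sum>i\<in>insert s S. r i *\<^sub>R b' i) = r s *\<^sub>R bs + (\<Sum>i\<in>S. r i *\<^sub>R b i)" for r
  proof -
    have "(\<Sum>i\<in>S. r i *\<^sub>R b' i) = (\<Sum>i\<in>S. r i *\<^sub>R b i)"
      using insert by (intro sum.cong) (auto simp: b'_def)
    then show ?thesis using insert by (simp add: b'_def)
  qed
  have mult: "of_int k *\<^sub>R bs \<in> \<Lambda>'" for k :: int
  proof -
    have nat: "real j *\<^sub>R bs \<in> \<Lambda>'" for j
    proof (induction j)
      case (Suc j)
      then have "real j *\<^sub>R bs - (0 - bs) \<in> \<Lambda>'" using diff' bs \<open>0 \<in> \<Lambda>'\<close> by blast
      then show ?case by (simp add: algebra_simps)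
    qed (use \<open>0 \<in> \<Lambda>'\<close> in simp)
    show ?thesis
    proof (cases "k \<ge> 0")
      case True
      then show ?thesis using nat [of "nat k"] by simp
    next
      case False
      then have "0 - real (nat (- k)) *\<^sub>R bs \<in> \<Lambda>'" using nat diff' \<open>0 \<in> \<Lambda>'\<close> by blast
      then show ?thesis using False by simp
    qed
  qed
  show ?case
    unfolding basis_within_def
  proof (intro exI [of _ b'] conjI ballI allI impI)
    show "b' i \<in> \<Lambda>" if "i \<in> insert s S" for i
      using that b bs by (auto simp: b'_def \<Lambda>'_def)
    show "b' i $ j = 0" if "i \<in> insert s S" "j \<notin> insert s S" for i j
      using that supp bs by (auto simp: b'_def \<Lambda>'_def)
  next
    fix x assume "x \<in> \<Lambda>" "\<forall>i. i \<notin> insert s S \<longrightarrow> x $ i = 0"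
    then have x: "x \<in> \<Lambda>'" by (simp add: \<Lambda>'_def)
    obtain l :: int where l: "x $ s = \<kappa> * of_int l" using grid \<open>x \<in> \<Lambda>\<close> by blast
    then have "l \<in> G" using x by (auto simp: G_def)
    then obtain t where t: "l = g * t" using g(3) by blast
    define y where "y = x - of_int t *\<^sub>R bs"
    have y: "y \<in> \<Lambda>'" unfolding y_def using x mult diff' by blast
    moreover have "y $ s = 0" by (simp add: y_def l bs t)
    ultimately have "\<forall>i. i \<notin> S \<longrightarrow> y $ i = 0" by (auto simp: \<Lambda>'_def)
    then obtain k :: "'n \<Rightarrow> int" where k: "y = (\<Sum>i\<in>S. of_int (k i) *\<^sub>R b i)"
      using gen y by (auto simp: \<Lambda>'_def)
    have "(\<Sum>i\<in>S. of_int ((k(s := t)) i) *\<^sub>R b i) = (\<Sum>i\<in>S. of_int (k i) *\<^sub>R b i)"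
      using insert by (intro sum.cong) auto
    then have "x = (\<Sum>i\<in>insert s S. of_int ((k(s := t)) i) *\<^sub>R b' i)"
      unfolding sum' using k by (simp add: y_def algebra_simps)
    then show "\<exists>k::'n \<Rightarrow> int. x = (\<Sum>i\<in>insert s S. of_int (k i) *\<^sub>R b' i)" by blast
  next
    fix r :: "'n \<Rightarrow> real" and i
    assume 0: "(\<Sum>i\<in>insert s S. r i *\<^sub>R b' i) = 0" and i: "i \<in> insert s S"
    then have "(r s *\<^sub>R bs + (\<Sum>i\<in>S. r i *\<^sub>R b i)) $ s = 0" unfolding sum' by simp
    moreover have "(\<Sum>i\<in>S. r i *\<^sub>R b i) $ s = 0"
      using supp insert by (simp add: sum_component)
    ultimately have rs: "r s = 0" using bs \<open>\<kappa> > 0\<close> g by simp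
    then have "(\<Sum>i\<in>S. r i *\<^sub>R b i) = 0" using 0 unfolding sum' by simp
    then show "r i = 0" using ind rs i by blast
  qed
qed

lemma full_latticeI:
  fixes \<Lambda> :: "(real ^ 'n) set"
  assumes zero: "0 \<in> \<Lambda>" and diff: "\<And>x y. x \<in> \<Lambda> \<Longrightarrow> y \<in> \<Lambda> \<Longrightarrow> x - y \<in> \<Lambda>"
    and "\<kappa> > 0" and grid: "\<And>x i. x \<in> \<Lambda> \<Longrightarrow> \<exists>k::int. x $ i = \<kappa> * of_int k"
    and "Q > 0" and axes: "\<And>i. axis i (\<kappa> * of_int Q) \<in> \<Lambda>"
  shows "full_lattice \<Lambda>"
proof -
  obtain b where "basis_within \<Lambda> UNIV b"
    using triangular_basis [OF assms, of UNIV] by auto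
  then have b: "\<And>i::'n. b i \<in> \<Lambda>"
    and gen: "\<And>x. x \<in> \<Lambda> \<Longrightarrow> \<exists>k::'n \<Rightarrow> int. x = (\<Sum>i\<in>UNIV. of_int (k i) *\<^sub>R b i)"
    and ind: "\<And>r :: 'n \<Rightarrow> real. (\<Sum>i\<in>UNIV. r i *\<^sub>R b i) = 0 \<Longrightarrow> (\<forall>i. r i = 0)"
    by (simp_all add: basis_within_def)
  have inj: "inj b"
  proof (rule injI, rule ccontr)
    fix i j assume eq: "b i = b j" and "i \<noteq> j"
    let ?r = "\<lambda>k. (if k = i then 1 else 0) - (if k = j then 1 else 0 :: real)"
    have "(\<Sum>k\<in>UNIV. ?r k *\<^sub>R b k) = 0"
    proof -
      have "(\<Sum>k\<in>UNIV. (if k = l then 1 else 0 :: real) *\<^sub>R b k) = b l" for l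
        using sum.delta [of UNIV l b] by (simp add: if_distrib [of "\<lambda>x. x *\<^sub>R _"] cong: if_cong)
      then show ?thesis by (simp add: scaleR_diff_left sum_subtractf eq)
    qed
    from ind [OF this] show False using \<open>i \<noteq> j\<close> by (auto dest!: spec [of _ i])
  qed
  have "independent (range b)"
  proof
    assume "dependent (range b)"
    then obtain u v where "v \<in> range b" "u v \<noteq> 0" "(\<Sum>v\<in>range b. u v *\<^sub>R v) = 0"
      by (auto simp: dependent_finite)
    then show False using ind [of "\<lambda>i. u (b i)"] inj by (auto simp: sum.reindex)
  qed
  moreover have add: "x + y \<in> \<Lambda>" if "x \<in> \<Lambda>" "y \<in> \<Lambda>" for x y
    using diff [OF that(1) diff [OF zero that(2)]] by simp
  have nat: "real j *\<^sub>R b i \<in> \<Lambda>" for j i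
    by (induction j) (use zero b add in \<open>auto simp: algebra_simps\<close>)
  have mult: "of_int k *\<^sub>R b i \<in> \<Lambda>" for k :: int and i
  proof (cases "k \<ge> 0")
    case True
    then show ?thesis using nat [of "nat k"] by simp
  next
    case False
    then show ?thesis using diff [OF zero nat [of "nat (- k)" i]] by simp
  qed
  have "(\<Sum>i\<in>S. of_int (k i) *\<^sub>R b i) \<in> \<Lambda>" if "finite S" for S :: "'n set" and k :: "'n \<Rightarrow> int"
    using that by (induction S) (auto intro: zero add mult)
  ultimately show ?thesis
    unfolding full_lattice_def using inj gen by (intro exI [of _ b]) auto
qed

section \<open>Failure of equivariance\<close>

lemma orthogonal_preserves_products:
  assumes "A \<in> orthogonal_group N"
  shows "(\<Sum>k<N. mapply N A p k * mapply N A q k) = (\<Sum>i<N. p i * q i)"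
proof -
  have "(\<Sum>k<N. mapply N A p k * mapply N A q k) =
      (\<Sum>k<N. \<Sum>i<N. \<Sum>j<N. p i * q j * (A k i * A k j))"
    by (simp add: mapply_def sum_product algebra_simps)
  also have "\<dots> = (\<Sum>i<N. \<Sum>j<N. \<Sum>k<N. p i * q j * (A k i * A k j))"
    by (subst sum.swap) (rule sum.cong [OF refl], rule sum.swap)
  also have "\<dots> = (\<Sum>i<N. \<Sum>j<N. p i * q j * (if i = j then 1 else 0))"
    using assms by (simp add: sum_distrib_left [symmetric] orthogonal_group_def)
  also have "\<dots> = (\<Sum>i<N. p i * q i)"
    by (simp add: if_distrib [of "\<lambda>x. _ * x"] cong: if_cong)
  finally show ?thesis .
qed

context coupled_spectrum
begin

text \<open>
  Equivariance makes the Gram function invariant under simultaneous translation of both arguments. For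
  the pair \<open>(h, 0)\<close> with \<open>h\<close> orthogonal to \<open>m\<close>, the translation with \<open>m \<bullet> a = \<pi>/2\<close> exchanges the
  factors \<open>cos (m \<bullet> x) cos (m \<bullet> y)\<close> and \<open>sin (m \<bullet> x) sin (m \<bullet> y)\<close>, that is, it replaces the integral
  over \<open>K\<close> by the one over \<open>M\<close>.
\<close>

lemma torus_not_equivariant:
  assumes "m \<noteq> 0" "m \<bullet> h = 0"
    and "wsum K (\<lambda>u. cos (u \<bullet> h)) \<noteq> wsum M (\<lambda>u. cos (u \<bullet> h))"
  shows "\<not> equivariant (length waves) \<Lambda> torus"
proof
  assume "equivariant (length waves) \<Lambda> torus"
  then obtain \<Phi> where \<Phi>: "torus_hom (length waves) \<Lambda> \<Phi>"
    and hom: "\<forall>x a. torus (x + a) = mapply (length waves) (\<Phi> a) (torus x)"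
    unfolding equivariant_def by auto
  have "\<Phi> a \<in> orthogonal_group (length waves)" for a
    using \<Phi> by (auto simp: torus_hom_def)
  then have inv: "(\<Sum>i<length waves. torus (x + a) i * torus (y + a) i) =
      (\<Sum>i<length waves. torus x i * torus y i)" for x y a
    using hom by (simp add: orthogonal_preserves_products)
  define a where "a = (pi / (2 * (m \<bullet> m))) *\<^sub>R m"
  have "m \<bullet> a = pi / 2" using \<open>m \<noteq> 0\<close> by (simp add: a_def)
  then have "cos (m \<bullet> a) = 0" "sin (m \<bullet> a) = 1"
    by (simp_all only: cos_pi_half sin_pi_half)
  then have "wsum K (\<lambda>u. cos (u \<bullet> h)) = wsum M (\<lambda>u. cos (u \<bullet> h))"
    using inv [of h a 0] \<open>m \<bullet> h = 0\<close> unfolding kernel_of_torus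
    by (simp add: inner_add_right)
  with assms show False by simp
qed

end

section \<open>The period lattice and the embedding\<close>

text \<open>
  The frequencies of \<open>L\<close> lie in the grid \<open>(\<kappa>/Q)\<int>\<^sup>n\<close> and include \<open>\<kappa>\<close> times each coordinate vector, so
  the periods lie between \<open>(2\<pi>Q/\<kappa>)\<int>\<^sup>n\<close> and \<open>(2\<pi>/\<kappa>)\<int>\<^sup>n\<close>. Since the frequencies \<open>u \<plusminus> m\<close> of the modulated waves occur in
  \<open>L\<close> as well, these waves share all periods of the plain ones.
\<close>

locale commensurable_spectrum = coupled_spectrum L K M m B
  for L K M :: "(real \<times> (real ^ 'n)) list" and m B +
  fixes \<kappa> :: real and Q :: int
  assumes pos: "\<kappa> > 0" "Q > 0"
    and axes: "\<And>i. \<exists>a. (a, axis i \<kappa>) \<in> set L"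
    and grid: "\<And>a u i. (a, u) \<in> set L \<Longrightarrow> \<exists>k::int. of_int Q * u $ i = \<kappa> * of_int k"
    and sidebands: "\<And>a u. (a, u) \<in> set K \<union> set M \<Longrightarrow>
          (\<exists>a. (a, u + m) \<in> set L) \<and> (\<exists>a. (a, u - m) \<in> set L)"
begin

definition periods :: "(real ^ 'n) set" where
  "periods = {x. \<forall>a u. (a, u) \<in> set L \<longrightarrow> (\<exists>k::int. u \<bullet> x = 2 * pi * of_int k)}"

text \<open>
  The plain waves alone separate points modulo periods, since their weights are positive.
\<close>

lemma torus_fibres: "torus x = torus y \<longleftrightarrow> x - y \<in> periods"
proof
  assume eq: "torus x = torus y"
  have eq': "h x = h y" if "h \<in> set waves" for h
  proof -
    obtain i where "i < length waves" "h = waves ! i"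
      using \<open>h \<in> set waves\<close> by (auto simp: in_set_conv_nth)
    then show ?thesis using fun_cong [OF eq, of i] by (simp add: torus_def)
  qed
  have "\<exists>k::int. u \<bullet> (x - y) = 2 * pi * of_int k" if au: "(a, u) \<in> set L" for a u
  proof -
    have "wave (sqrt a) 0 0 0 u \<in> set waves" "wave (sqrt a) 0 (pi / 2) 0 u \<in> set waves"
      using au unfolding waves_def block_def by force+
    from this [THEN eq'] have "cos (u \<bullet> x) = cos (u \<bullet> y)" "sin (u \<bullet> x) = sin (u \<bullet> y)"
      using weights_L [OF au] by (simp_all add: wave_def)
    then obtain k :: int where "u \<bullet> x = u \<bullet> y + 2 * pi * of_int k"
      using sin_cos_eq_iff by blast
    then show ?thesis by (intro exI [of _ k]) (simp add: inner_diff_right)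
  qed
  then show "x - y \<in> periods" by (simp add: periods_def)
next
  assume per: "x - y \<in> periods"
  have per': "\<exists>k::int. u \<bullet> x = u \<bullet> y + 2 * pi * of_int k" if au: "(a, u) \<in> set L" for a u
  proof -
    obtain k :: int where "u \<bullet> (x - y) = 2 * pi * of_int k"
      using per au unfolding periods_def by blast
    then show ?thesis by (intro exI [of _ k]) (simp add: inner_diff_right)
  qed
  have shift: "cos (u \<bullet> x - \<alpha>) = cos (u \<bullet> y - \<alpha>)" if au: "(a, u) \<in> set L" for a u \<alpha>
  proof -
    obtain k :: int where k: "u \<bullet> x = u \<bullet> y + 2 * pi * of_int k" using per' [OF au] by blast
    have "u \<bullet> x - \<alpha> = (u \<bullet> y - \<alpha>) + 2 * pi * of_int k" unfolding k by simp
    then show ?thesis using sin_cos_eq_iff by blast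
  qed
  have sb: "wave A \<phi> \<psi> m u x = wave A \<phi> \<psi> m u y" if au: "(a, u) \<in> set K \<union> set M" for A \<phi> \<psi> a u
  proof -
    obtain a' a'' where "(a', u + m) \<in> set L" "(a'', u - m) \<in> set L"
      using sidebands [OF au] by blast
    then show ?thesis unfolding wave_eq_sum using shift by metis
  qed
  have L0: "wave A \<phi> \<psi> 0 u x = wave A \<phi> \<psi> 0 u y" if "(a, u) \<in> set L" for A \<phi> \<psi> a u
    using shift [OF that] by (simp add: wave_def)
  have "h x = h y" if "h \<in> set waves" for h
    using that sb L0 unfolding waves_def block_def by fastforce
  then show "torus x = torus y"
    by (simp add: torus_def fun_eq_iff)
qed

lemma full_lattice_periods: "full_lattice periods"
proof (rule full_latticeI)
  show "0 \<in> periods" by (auto simp: periods_def intro: exI [of _ 0])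
  show "x - y \<in> periods" if xy: "x \<in> periods" "y \<in> periods" for x y
    unfolding periods_def
  proof (clarify)
    fix a u assume "(a, u) \<in> set L"
    then obtain k l :: int where "u \<bullet> x = 2 * pi * of_int k" "u \<bullet> y = 2 * pi * of_int l"
      using xy unfolding periods_def by blast
    then show "\<exists>k::int. u \<bullet> (x - y) = 2 * pi * of_int k"
      by (intro exI [of _ "k - l"]) (simp add: inner_diff_right algebra_simps)
  qed
  show "2 * pi / \<kappa> > 0" using pos by simp
  show "\<exists>k::int. x $ i = 2 * pi / \<kappa> * of_int k" if x: "x \<in> periods" for x i
  proof -
    obtain a where "(a, axis i \<kappa>) \<in> set L" using axes by blast
    then obtain k :: int where "axis i \<kappa> \<bullet> x = 2 * pi * of_int k"
      using x unfolding periods_def by blast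
    then show ?thesis using pos by (intro exI [of _ k]) (simp add: inner_axis' field_simps)
  qed
  show "Q > 0" by (rule pos)
  show "axis i (2 * pi / \<kappa> * of_int Q) \<in> periods" for i
    unfolding periods_def
  proof (clarify)
    fix a u assume "(a, u) \<in> set L"
    then obtain k :: int where "of_int Q * u $ i = \<kappa> * of_int k" using grid by blast
    then show "\<exists>k::int. u \<bullet> axis i (2 * pi / \<kappa> * of_int Q) = 2 * pi * of_int k"
      using pos by (intro exI [of _ k]) (simp add: inner_axis field_simps)
  qed
qed

lemma periods_cocompact:
  "\<exists>y \<in> cbox 0 (\<chi> i. 2 * pi / \<kappa> * of_int Q). x - y \<in> periods"
proof -
  define T where "T = 2 * pi / \<kappa> * of_int Q"
  have "T > 0" using pos by (simp add: T_def)
  define l :: "real ^ 'n" where "l = (\<chi> i. T * of_int \<lfloor>x $ i / T\<rfloor>)"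
  have "l \<in> periods"
    unfolding periods_def
  proof (clarify)
    fix a u assume "(a, u) \<in> set L"
    then obtain k :: "'n \<Rightarrow> int" where k: "\<And>i. of_int Q * u $ i = \<kappa> * of_int (k i)"
      using grid by metis
    have "u $ i * T = 2 * pi * of_int (k i)" for i
      using k [of i] pos by (simp add: T_def field_simps)
    then have "u \<bullet> l = (\<Sum>i\<in>UNIV. 2 * pi * of_int (k i) * of_int \<lfloor>x $ i / T\<rfloor>)"
      by (simp add: inner_vec_def l_def mult.assoc [symmetric])
    then show "\<exists>k::int. u \<bullet> l = 2 * pi * of_int k"
      by (intro exI [of _ "\<Sum>i\<in>UNIV. k i * \<lfloor>x $ i / T\<rfloor>"]) (simp add: sum_distrib_left mult.assoc)
  qed
  moreover have "x - l \<in> cbox 0 (\<chi> i. T)"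
    unfolding mem_box_cart
  proof (intro allI)
    fix i
    define z where "z = real_of_int \<lfloor>x $ i / T\<rfloor>"
    have "z \<le> x $ i / T" "x $ i / T \<le> z + 1"
      unfolding z_def by linarith+
    then show "(0::real ^ 'n) $ i \<le> (x - l) $ i \<and> (x - l) $ i \<le> (\<chi> i. T) $ i"
      using \<open>T > 0\<close> by (simp add: l_def field_simps flip: z_def)
  qed
  ultimately show ?thesis
    unfolding T_def by (intro bexI [of _ "x - l"]) (auto simp: T_def)
qed

text \<open>
  The restriction to a compact box meeting all cosets is a closed map onto the image, hence a quotient
  map, and it is the torus map composed with an inclusion.
\<close>

lemma torus_quotient_map:
  "quotient_map euclidean (subtopology (Euclidean_space (length waves)) (range torus)) torus"
proof -
  let ?Y = "subtopology (Euclidean_space (length waves)) (range torus)"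
  let ?B = "cbox 0 (\<chi> i. 2 * pi / \<kappa> * of_int Q) :: (real ^ 'n) set"
  have cont: "continuous_map euclidean ?Y torus"
  proof -
    have "continuous_map euclidean euclideanreal (\<lambda>x. (waves ! i) x)" if "i < length waves" for i
    proof -
      obtain A \<phi> \<psi> k u where "waves ! i = wave A \<phi> \<psi> k u"
        by (rule waves_are_waves [OF nth_mem [OF \<open>i < length waves\<close>]])
      then show ?thesis
        by (auto simp: wave_def intro!: continuous_intros)
    qed
    then have "continuous_map euclidean (Euclidean_space (length waves)) torus"
      unfolding torus_def [abs_def] continuous_map_componentwise_Euclidean_space by blast
    then show ?thesis by (simp add: continuous_map_in_subtopology)
  qed
  have "torus ` ?B = range torus"
  proof -
    have "torus x \<in> torus ` ?B" for x
      using periods_cocompact [of x] torus_fibres by auto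
    then show ?thesis by auto
  qed
  then have img: "torus ` topspace (top_of_set ?B) = topspace ?Y"
    using torus_immersion by (auto simp: immersion_def smooth_map_def)
  have haus: "Hausdorff_space ?Y"
    by (intro Hausdorff_space_subtopology)
       (simp add: Euclidean_space_def Hausdorff_space_subtopology Hausdorff_space_product_topology)
  have contB: "continuous_map (top_of_set ?B) ?Y torus"
    using cont by (rule continuous_map_from_subtopology)
  have "closed_map (top_of_set ?B) ?Y torus"
    using contB haus by (intro continuous_imp_closed_map) (auto simp: compact_space_subtopology)
  then have "quotient_map (top_of_set ?B) ?Y torus"
    using contB img by (intro continuous_closed_imp_quotient_map)
  then have "quotient_map (top_of_set ?B) ?Y (torus \<circ> id)"
    by simp
  then show ?thesis
    using cont by (intro quotient_map_from_composition [of "top_of_set ?B" euclidean id ?Y torus])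
       (auto simp: continuous_map_from_subtopology)
qed

theorem torus_embedding: "smooth_torus_embedding (length waves) periods torus"
  unfolding smooth_torus_embedding_def
  using torus_immersion torus_fibres torus_quotient_map by blast

end

section \<open>Designs and their suspension\<close>

lemma wsum_push_id [simp]: "wsum (push r id L) g = r * wsum L g"
  by (simp add: wsum_push)

lemma set_push: "(b, y) \<in> set (push r T L) \<longleftrightarrow> (\<exists>a u. (a, u) \<in> set L \<and> b = r * a \<and> y = T u)"
  by (force simp: push_def)

definition sqnorm_on :: "'n set \<Rightarrow> real ^ 'n \<Rightarrow> real" where
  "sqnorm_on S v = (\<Sum>i\<in>S. (v $ i)\<^sup>2)"

text \<open>
  The moments of orders 0, 2 and 4 of the uniform probability measure on the unit sphere of \<open>\<real>\<^sup>S\<close>: a weighted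
  spherical 4-design up to the symmetry \<open>u \<mapsto> - u\<close>.
\<close>

definition design :: "'n set \<Rightarrow> (real \<times> (real ^ 'n)) list \<Rightarrow> bool" where
  "design S D \<longleftrightarrow> mass D = 1 \<and>
     (\<forall>v. wsum D (\<lambda>u. (u \<bullet> v)\<^sup>2) = sqnorm_on S v / real (card S)) \<and>
     (\<forall>v. wsum D (\<lambda>u. (u \<bullet> v) ^ 4) = 3 * (sqnorm_on S v)\<^sup>2 / (real (card S) * (real (card S) + 2)))"

definition rational_positive :: "(real \<times> (real ^ 'n)) list \<Rightarrow> bool" where
  "rational_positive D \<longleftrightarrow> (\<forall>a u. (a, u) \<in> set D \<longrightarrow> a > 0 \<and> (\<forall>i. u $ i \<in> \<rat>))"

lemma rational_positive_simps [simp]: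
  "rational_positive []"
  "rational_positive ((a, u) # D) \<longleftrightarrow> a > 0 \<and> (\<forall>i. u $ i \<in> \<rat>) \<and> rational_positive D"
  "rational_positive (D @ E) \<longleftrightarrow> rational_positive D \<and> rational_positive E"
  by (auto simp: rational_positive_def)

lemma rational_positive_push:
  assumes "rational_positive D" "r > 0" "\<And>u i. (\<And>j. u $ j \<in> \<rat>) \<Longrightarrow> T u $ i \<in> \<rat>"
  shows "rational_positive (push r T D)"
  using assms unfolding rational_positive_def by (auto simp: set_push)

text \<open>
  Two parallel copies of \<open>s D\<close> at heights \<open>c\<close> and \<open>- c\<close> in the new direction \<open>z\<close>, of total weight \<open>p\<close>.
\<close>

definition layer :: "real \<Rightarrow> real \<Rightarrow> real \<Rightarrow> 'n \<Rightarrow> (real \<times> (real ^ 'n)) list \<Rightarrow> (real \<times> (real ^ 'n)) list" where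
  "layer p s c z D =
     push (p / 2) (\<lambda>u. s *\<^sub>R u + c *\<^sub>R axis z 1) D @ push (p / 2) (\<lambda>u. s *\<^sub>R u - c *\<^sub>R axis z 1) D"

lemma mass_layer [simp]: "mass (layer p s c z D) = p * mass D"
  by (simp add: layer_def)

lemma wsum_layer:
  "wsum (layer p s c z D) g =
     p / 2 * wsum D (\<lambda>u. g (s *\<^sub>R u + c *\<^sub>R axis z 1) + g (s *\<^sub>R u - c *\<^sub>R axis z 1))"
  by (simp add: layer_def wsum_push wsum_add algebra_simps)

lemma wsum_layer_append [simp]:
  "wsum (layer p s c z (D @ E)) g = wsum (layer p s c z D) g + wsum (layer p s c z E) g"
  by (simp add: layer_def push_def)

lemma wsum_layer_push [simp]:
  "wsum (layer p s c z (push r id D)) g = wsum (layer (p * r) s c z D) g"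
  unfolding wsum_layer by simp

lemma second_moment_layer:
  "wsum (layer p s c z D) (\<lambda>u. (u \<bullet> v)\<^sup>2) =
     p * (s\<^sup>2 * wsum D (\<lambda>u. (u \<bullet> v)\<^sup>2) + c\<^sup>2 * (v $ z)\<^sup>2 * mass D)"
proof -
  have "((s *\<^sub>R u + c *\<^sub>R axis z 1) \<bullet> v)\<^sup>2 + ((s *\<^sub>R u - c *\<^sub>R axis z 1) \<bullet> v)\<^sup>2 =
      2 * s\<^sup>2 * (u \<bullet> v)\<^sup>2 + 2 * c\<^sup>2 * (v $ z)\<^sup>2" for u
    by (simp add: inner_add_left inner_diff_left inner_axis' power2_eq_square algebra_simps)
  then show ?thesis
    unfolding wsum_layer by (simp add: wsum_add wsum_cmult algebra_simps)
qed

lemma fourth_moment_layer: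
  "wsum (layer p s c z D) (\<lambda>u. (u \<bullet> v) ^ 4) =
     p * (s ^ 4 * wsum D (\<lambda>u. (u \<bullet> v) ^ 4) +
          6 * s\<^sup>2 * c\<^sup>2 * (v $ z)\<^sup>2 * wsum D (\<lambda>u. (u \<bullet> v)\<^sup>2) + c ^ 4 * (v $ z) ^ 4 * mass D)"
proof -
  have "((s *\<^sub>R u + c *\<^sub>R axis z 1) \<bullet> v) ^ 4 + ((s *\<^sub>R u - c *\<^sub>R axis z 1) \<bullet> v) ^ 4 =
      2 * s ^ 4 * (u \<bullet> v) ^ 4 + 12 * s\<^sup>2 * c\<^sup>2 * (v $ z)\<^sup>2 * (u \<bullet> v)\<^sup>2 + 2 * c ^ 4 * (v $ z) ^ 4" for u
    by (simp add: inner_add_left inner_diff_left inner_axis' power2_eq_square power4_eq_xxxx algebra_simps)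
  then show ?thesis
    unfolding wsum_layer by (simp add: wsum_add wsum_cmult algebra_simps)
qed

text \<open>
  Coefficient comparison in the moments of the suspension: a design \<open>D\<close> in dimension \<open>k\<close> is placed on
  the equator with weight \<open>p0\<close> and on the parallels of height \<open>\<plusminus> c\<close> and radius \<open>s\<close> with weight \<open>p\<close>,
  and the pole gets weight \<open>p1\<close>.
\<close>

definition suspension_weights :: "real \<Rightarrow> real \<Rightarrow> real \<Rightarrow> real \<Rightarrow> real \<Rightarrow> real \<Rightarrow> bool" where
  "suspension_weights k p0 p1 p s c \<longleftrightarrow>
     p0 + p1 + p = 1 \<and> p0 + p * s\<^sup>2 = k / (k + 1) \<and> p1 + p * c\<^sup>2 = 1 / (k + 1) \<and>
     p0 + p * s ^ 4 = k * (k + 2) / ((k + 1) * (k + 3)) \<and>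
     p * s\<^sup>2 * c\<^sup>2 = k / ((k + 1) * (k + 3)) \<and>
     p1 + p * c ^ 4 = 3 / ((k + 1) * (k + 3))"

lemma design_suspension:
  assumes "design S D" "finite S" "S \<noteq> {}" "z \<notin> S" "suspension_weights (real (card S)) p0 p1 p s c"
  shows "design (insert z S) (push p0 id D @ (p1, axis z 1) # layer p s c z D)"
proof -
  define k where "k = real (card S)"
  have k: "k > 0" using assms by (auto simp: k_def card_gt_0_iff)
  have D0: "mass D = 1" and D2: "\<And>v. wsum D (\<lambda>u. (u \<bullet> v)\<^sup>2) = sqnorm_on S v / k"
    and D4: "\<And>v. wsum D (\<lambda>u. (u \<bullet> v) ^ 4) = 3 * (sqnorm_on S v)\<^sup>2 / (k * (k + 2))"
    using assms(1) unfolding design_def k_def by blast+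
  have w: "p0 + p1 + p = 1" "p0 + p * s\<^sup>2 = k / (k + 1)" "p1 + p * c\<^sup>2 = 1 / (k + 1)"
     "p0 + p * s ^ 4 = k * (k + 2) / ((k + 1) * (k + 3))"
     "p * s\<^sup>2 * c\<^sup>2 = k / ((k + 1) * (k + 3))"
     "p1 + p * c ^ 4 = 3 / ((k + 1) * (k + 3))"
    using assms(5) unfolding suspension_weights_def k_def by blast+
  have sq: "sqnorm_on (insert z S) v = (v $ z)\<^sup>2 + sqnorm_on S v" for v
    using assms by (simp add: sqnorm_on_def)
  have card: "real (card (insert z S)) = k + 1"
    using assms by (simp add: k_def)
  show ?thesis
    unfolding design_def card sq
  proof (intro conjI allI)
    show "mass (push p0 id D @ (p1, axis z 1) # layer p s c z D) = 1"
      using w(1) by (simp add: D0)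
    fix v
    let ?\<sigma> = "sqnorm_on S v" and ?\<zeta> = "v $ z"
    have "wsum (push p0 id D @ (p1, axis z 1) # layer p s c z D) (\<lambda>u. (u \<bullet> v)\<^sup>2) =
        (p0 + p * s\<^sup>2) * (?\<sigma> / k) + (p1 + p * c\<^sup>2) * ?\<zeta>\<^sup>2"
      by (simp add: second_moment_layer D0 D2 inner_axis' algebra_simps add_divide_distrib)
    also have "\<dots> = (?\<zeta>\<^sup>2 + ?\<sigma>) / (k + 1)"
      unfolding w using k by (simp add: add_divide_distrib)
    finally show "wsum (push p0 id D @ (p1, axis z 1) # layer p s c z D) (\<lambda>u. (u \<bullet> v)\<^sup>2) =
        (?\<zeta>\<^sup>2 + ?\<sigma>) / (k + 1)" .
    have "wsum (push p0 id D @ (p1, axis z 1) # layer p s c z D) (\<lambda>u. (u \<bullet> v) ^ 4) =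
        (p0 + p * s ^ 4) * (3 * ?\<sigma>\<^sup>2 / (k * (k + 2))) + 6 * (p * s\<^sup>2 * c\<^sup>2) * ?\<zeta>\<^sup>2 * (?\<sigma> / k) +
        (p1 + p * c ^ 4) * ?\<zeta> ^ 4"
      by (simp add: fourth_moment_layer D0 D2 D4 inner_axis' algebra_simps add_divide_distrib)
    also have "\<dots> = (3 * ?\<sigma>\<^sup>2 + 6 * ?\<zeta>\<^sup>2 * ?\<sigma> + 3 * ?\<zeta> ^ 4) / ((k + 1) * (k + 3))"
    proof -
      have "k * (k + 2) / ((k + 1) * (k + 3)) * (3 * ?\<sigma>\<^sup>2 / (k * (k + 2))) = 3 * ?\<sigma>\<^sup>2 / ((k + 1) * (k + 3))"
        using k by simp
      moreover have "6 * (k / ((k + 1) * (k + 3))) * ?\<zeta>\<^sup>2 * (?\<sigma> / k) = 6 * ?\<zeta>\<^sup>2 * ?\<sigma> / ((k + 1) * (k + 3))"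
        using k by simp
      ultimately show ?thesis unfolding w by (simp add: add_divide_distrib)
    qed
    also have "\<dots> = 3 * (?\<zeta>\<^sup>2 + ?\<sigma>)\<^sup>2 / ((k + 1) * (k + 1 + 2))"
      by (simp add: power2_eq_square power4_eq_xxxx algebra_simps)
    finally show "wsum (push p0 id D @ (p1, axis z 1) # layer p s c z D) (\<lambda>u. (u \<bullet> v) ^ 4) =
        3 * (?\<zeta>\<^sup>2 + ?\<sigma>)\<^sup>2 / ((k + 1) * (k + 1 + 2))" .
  qed
qed

text \<open>
  The rational points \<open>((j\<^sup>2 - 1)/(j\<^sup>2 + 1), 2j/(j\<^sup>2 + 1))\<close> of the unit circle have height \<open>c\<close> about \<open>2/j\<close>, and the
  admissible interval for \<open>c\<close> is wide enough to contain one of these heights.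
\<close>

lemma rational_circle_point:
  fixes N :: real
  assumes "N \<ge> 5"
  obtains s c :: real where "s \<in> \<rat>" "c \<in> \<rat>" "s > 0" "c > 0" "s\<^sup>2 + c\<^sup>2 = 1"
    "1 < N * c\<^sup>2" "N * c\<^sup>2 < 3"
proof -
  define r where "r = sqrt N"
  have r: "r\<^sup>2 = N" "r > 2" "r \<ge> 0"
    using assms by (auto simp: r_def real_less_rsqrt)
  \<comment> \<open>The upper bound on \<open>c\<close> holds if \<open>j \<ge> \<surd>(4/3) r\<close>, and \<open>7/6\<close> is slightly larger than \<open>\<surd>(4/3)\<close>;
    the lower bound amounts to \<open>j + 1/j < 2 r\<close>, which leaves room for rounding up.\<close>
  define j where "j = real_of_int \<lceil>7 / 6 * r\<rceil>"
  have j: "7 / 6 * r \<le> j" "j < 7 / 6 * r + 1"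
    unfolding j_def by linarith+
  have "2 < \<lceil>7 / 6 * r\<rceil>" unfolding less_ceiling_iff using r by simp
  then have "3 \<le> \<lceil>7 / 6 * r\<rceil>" by linarith
  then have j3: "j \<ge> 3" unfolding j_def by linarith
  define d where "d = j\<^sup>2 + 1"
  have d: "d > 0" by (simp add: d_def add_nonneg_pos)
  show ?thesis
  proof (rule that)
    show "(j\<^sup>2 - 1) / d \<in> \<rat>" "2 * j / d \<in> \<rat>" by (auto simp: d_def j_def)
    have "j * j > 1 * 1" using j3 by (intro mult_strict_mono) auto
    then show "(j\<^sup>2 - 1) / d > 0" using d by (simp add: power2_eq_square)
    show "2 * j / d > 0" using d j3 by simp
    have "(j\<^sup>2 - 1)\<^sup>2 + (2 * j)\<^sup>2 = d\<^sup>2"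
      by (simp add: d_def power2_eq_square algebra_simps)
    then show "((j\<^sup>2 - 1) / d)\<^sup>2 + (2 * j / d)\<^sup>2 = 1"
      using d by (simp add: power_divide flip: add_divide_distrib)
    have "d < 2 * j * r"
    proof -
      have "j * (2 * r - j) \<ge> 3 * (5 / 6 * r - 1)"
        using j j3 r by (intro mult_mono) linarith+
      then have "j * (2 * r - j) > 1"
        using r by argo
      then show ?thesis by (simp add: d_def power2_eq_square algebra_simps)
    qed
    then have "d\<^sup>2 < (2 * j * r)\<^sup>2" using d by (intro power_strict_mono) auto
    then show "1 < N * (2 * j / d)\<^sup>2"
      using d r(1) by (simp add: power_divide power_mult_distrib field_simps)
    have "(7 / 6 * r)\<^sup>2 \<le> j\<^sup>2" using j r by (intro power_mono) auto
    then have "4 * N \<le> 3 * j\<^sup>2" using r(1) assms by (simp add: power_mult_distrib power_divide)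
    then have "4 * N * j\<^sup>2 \<le> 3 * j\<^sup>2 * j\<^sup>2" by (intro mult_right_mono) auto
    also have "\<dots> < 3 * d\<^sup>2"
      using j3 by (simp add: d_def power2_eq_square algebra_simps add_pos_pos)
    finally show "N * (2 * j / d)\<^sup>2 < 3"
      using d by (simp add: power_divide power_mult_distrib field_simps)
  qed
qed

text \<open>
  The mixed moment \<open>p s\<^sup>2 c\<^sup>2\<close> determines \<open>p\<close>, after which the second moments determine \<open>p0\<close> and \<open>p1\<close>; the
  remaining equations then follow from \<open>s\<^sup>2 + c\<^sup>2 = 1\<close>. Positivity of \<open>p0\<close> and \<open>p1\<close> is exactly
  \<open>1 < (x + 3) c\<^sup>2 < 3\<close>, an open condition, so \<open>s\<close> and \<open>c\<close> can be rational.
\<close>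

lemma suspension_weights_exist:
  assumes x: "x \<ge> 2"
  obtains p0 p1 p s c where "p0 > 0" "p1 > 0" "p > 0" "s > 0" "c > 0" "s \<in> \<rat>" "c \<in> \<rat>"
    "suspension_weights x p0 p1 p s c"
proof -
  obtain s c where sc: "s \<in> \<rat>" "c \<in> \<rat>" "s > 0" "c > 0" "s\<^sup>2 + c\<^sup>2 = 1"
    "1 < (x + 3) * c\<^sup>2" "(x + 3) * c\<^sup>2 < 3"
    using rational_circle_point [of "x + 3"] x by auto
  define e where "e = x / ((x + 1) * (x + 3))"
  define p where "p = e / (s\<^sup>2 * c\<^sup>2)"
  have e: "e > 0" using x by (simp add: e_def)
  have p: "p > 0" using sc e by (simp add: p_def)
  have pe: "p * s\<^sup>2 * c\<^sup>2 = e" using sc by (simp add: p_def)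
  define p0 p1 where "p0 = x / (x + 1) - p * s\<^sup>2" and "p1 = 1 / (x + 1) - p * c\<^sup>2"
  have "p * s\<^sup>2 = e / c\<^sup>2" using sc by (simp add: p_def)
  also have "\<dots> = x / (x + 1) / ((x + 3) * c\<^sup>2)"
    by (simp add: e_def)
  also have "\<dots> < x / (x + 1) / 1"
    using sc x by (intro divide_strict_left_mono) auto
  also have "\<dots> = x / (x + 1)" by simp
  finally have p0: "p0 > 0" by (simp add: p0_def)
  have s2: "s\<^sup>2 = 1 - c\<^sup>2" using sc by simp
  have "x < (x + 3) * s\<^sup>2" using sc unfolding s2 by (simp add: algebra_simps)
  then have "x / ((x + 3) * s\<^sup>2) < 1"
    using sc x by simp
  then have "1 / (x + 1) * (x / ((x + 3) * s\<^sup>2)) < 1 / (x + 1) * 1"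
    using x by (intro mult_strict_left_mono) auto
  then have "e / s\<^sup>2 < 1 / (x + 1)"
    by (simp add: e_def mult.assoc)
  moreover have "p * c\<^sup>2 = e / s\<^sup>2" using sc by (simp add: p_def)
  ultimately have p1: "p1 > 0" by (simp add: p1_def)
  have p4: "p * s ^ 4 = p * s\<^sup>2 - e" "p * c ^ 4 = p * c\<^sup>2 - e"
  proof -
    have "p * s ^ 4 + e = p * s\<^sup>2 * (s\<^sup>2 + c\<^sup>2)" "p * c ^ 4 + e = p * c\<^sup>2 * (s\<^sup>2 + c\<^sup>2)"
      by (simp_all add: pe [symmetric] power2_eq_square power4_eq_xxxx algebra_simps)
    then show "p * s ^ 4 = p * s\<^sup>2 - e" "p * c ^ 4 = p * c\<^sup>2 - e" using sc by simp_all
  qed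
  have "suspension_weights x p0 p1 p s c"
    unfolding suspension_weights_def
  proof (intro conjI)
    show "p0 + p * s\<^sup>2 = x / (x + 1)" "p1 + p * c\<^sup>2 = 1 / (x + 1)"
      by (simp_all add: p0_def p1_def)
    have "p * s\<^sup>2 + p * c\<^sup>2 = p" using sc by (simp flip: distrib_left)
    moreover have "x / (x + 1) + 1 / (x + 1) = 1" using x by (simp flip: add_divide_distrib)
    ultimately show "p0 + p1 + p = 1" by (simp add: p0_def p1_def)
    show "p * s\<^sup>2 * c\<^sup>2 = x / ((x + 1) * (x + 3))" by (simp add: pe e_def)
    show "p0 + p * s ^ 4 = x * (x + 2) / ((x + 1) * (x + 3))"
      unfolding p4 p0_def e_def using x by (simp add: divide_simps) (simp add: algebra_simps)
    show "p1 + p * c ^ 4 = 3 / ((x + 1) * (x + 3))"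
      unfolding p4 p1_def e_def using x by (simp add: divide_simps) (simp add: algebra_simps)
  qed
  then show ?thesis using that p0 p1 p sc by blast
qed

section \<open>Two plane measures with equal moments\<close>

definition in_plane :: "'n \<Rightarrow> 'n \<Rightarrow> real \<Rightarrow> real \<Rightarrow> real ^ 'n" where
  "in_plane p q x y = x *\<^sub>R axis p 1 + y *\<^sub>R axis q 1"

text \<open>
  Two measures on the unit circle, symmetric under sign changes and exchange of the coordinates up to
  \<open>u \<mapsto> - u\<close>. Such measures have the same moments of orders 2 and 4 as soon as the masses and the moments
  \<open>\<Sum> a (u\<^sub>p u\<^sub>q)\<^sup>2\<close> agree. The latter are governed by \<open>(3/5)\<^sup>2(4/5)\<^sup>2 = 144/625\<close>, \<open>(5/13)\<^sup>2(12/13)\<^sup>2 = 3600/28561\<close> and,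
  for the coordinate vectors, \<open>0\<close>; this gives the weights \<open>15625 = 25 \<cdot> 625\<close> and \<open>28561 = 13\<^sup>4\<close>, and the
  two coordinate vectors share the missing mass, \<open>25872 = 2 (28561 - 15625)\<close> each. In the torus, the first
  measure is modulated by a cosine and the second by a sine.
\<close>

definition twin_cos :: "'n \<Rightarrow> 'n \<Rightarrow> (real \<times> (real ^ 'n)) list" where
  "twin_cos p q =
    [(25872, in_plane p q 1 0), (25872, in_plane p q 0 1),
     (15625, in_plane p q (3/5) (4/5)), (15625, in_plane p q (3/5) (-4/5)),
     (15625, in_plane p q (4/5) (3/5)), (15625, in_plane p q (4/5) (-3/5))]"

definition twin_sin :: "'n \<Rightarrow> 'n \<Rightarrow> (real \<times> (real ^ 'n)) list" where
  "twin_sin p q =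
    [(28561, in_plane p q (5/13) (12/13)), (28561, in_plane p q (5/13) (-12/13)),
     (28561, in_plane p q (12/13) (5/13)), (28561, in_plane p q (12/13) (-5/13))]"

lemma inner_in_plane: "in_plane p q x y \<bullet> v = x * v $ p + y * v $ q"
  by (simp add: in_plane_def inner_add_left inner_axis')

lemma mass_twins: "mass (twin_cos p q) = 114244" "mass (twin_sin p q) = 114244"
  by (simp_all add: twin_cos_def twin_sin_def)

lemma second_moment_twins:
  "wsum (twin_cos p q) (\<lambda>u. (u \<bullet> v)\<^sup>2) = 57122 * ((v $ p)\<^sup>2 + (v $ q)\<^sup>2)"
  "wsum (twin_sin p q) (\<lambda>u. (u \<bullet> v)\<^sup>2) = 57122 * ((v $ p)\<^sup>2 + (v $ q)\<^sup>2)"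
  by (simp_all add: twin_cos_def twin_sin_def inner_in_plane power2_eq_square field_simps)

lemma fourth_moment_twins:
  "wsum (twin_cos p q) (\<lambda>u. (u \<bullet> v) ^ 4) =
     42722 * ((v $ p) ^ 4 + (v $ q) ^ 4) + 86400 * (v $ p)\<^sup>2 * (v $ q)\<^sup>2"
  "wsum (twin_sin p q) (\<lambda>u. (u \<bullet> v) ^ 4) =
     42722 * ((v $ p) ^ 4 + (v $ q) ^ 4) + 86400 * (v $ p)\<^sup>2 * (v $ q)\<^sup>2"
  by (simp_all add: twin_cos_def twin_sin_def inner_in_plane power2_eq_square power4_eq_xxxx field_simps)

lemma rational_in_plane: "x \<in> \<rat> \<Longrightarrow> y \<in> \<rat> \<Longrightarrow> in_plane p q x y $ i \<in> \<rat>"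
  by (simp add: in_plane_def axis_def)

lemma rational_positive_twins: "rational_positive (twin_cos p q)" "rational_positive (twin_sin p q)"
  by (simp_all add: twin_cos_def twin_sin_def rational_in_plane)

lemma design_cong:
  assumes "design S D" "mass E = mass D" "\<And>g. wsum E g = wsum D g"
  shows "design S E"
  using assms by (simp add: design_def)

section \<open>Rational designs with a spare twin\<close>

text \<open>
  A rational design in the coordinates \<open>S\<close> from which a multiple of the first twin can be split off
  without losing a frequency: the rest \<open>R\<close> still contains the vectors of both twins and all
  coordinate vectors.
\<close>

definition spare_twin_design :: "'n \<Rightarrow> 'n \<Rightarrow> 'n set \<Rightarrow> (real \<times> (real ^ 'n)) list \<Rightarrow> real \<Rightarrow> bool" where
  "spare_twin_design p q S R \<epsilon> \<longleftrightarrow> \<epsilon> > 0 \<and> rational_positive R \<and> design S (R @ push \<epsilon> id (twin_cos p q)) \<and>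
     snd ` set (twin_cos p q @ twin_sin p q) \<subseteq> snd ` set R \<and> (\<lambda>i. axis i 1) ` S \<subseteq> snd ` set R"

lemma snd_set_push: "snd ` set (push r T D) = T ` snd ` set D"
  by (force simp: push_def)

lemma snd_set_layer:
  "snd ` set (layer p s c z D) =
     (\<lambda>u. s *\<^sub>R u + c *\<^sub>R axis z 1) ` snd ` set D \<union> (\<lambda>u. s *\<^sub>R u - c *\<^sub>R axis z 1) ` snd ` set D"
  by (simp add: layer_def image_Un snd_set_push)

lemma rational_positive_layer:
  assumes "rational_positive D" "r > 0" "s \<in> \<rat>" "c \<in> \<rat>"
  shows "rational_positive (layer r s c z D)"
  unfolding layer_def using assms by (auto intro!: rational_positive_push simp: axis_def)

lemma spare_twin_design_in_plane:
  assumes "p \<noteq> q"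
  shows "\<exists>R \<epsilon>. spare_twin_design p q {p, q} R \<epsilon>"
proof -
  \<comment> \<open>Either twin alone has a slightly too small moment \<open>\<Sum> a u\<^sub>p\<^sup>4\<close>, namely \<open>42722/114244\<close> instead of
    \<open>3/8\<close> after normalization. Twins of joint weight factor \<open>1/115200\<close> together with coordinate
    vectors of weight \<open>478/115200\<close> give the right value; that factor is distributed over the two
    copies of the first twin, a quarter each, and the second one, a half.\<close>
  define R where "R = [(478 / 115200, in_plane p q 1 0), (478 / 115200, in_plane p q 0 1)] @
    push (1 / 460800) id (twin_cos p q) @ push (1 / 230400) id (twin_sin p q)"
  have "rational_positive R"
    by (auto simp: R_def rational_in_plane rational_positive_twins intro!: rational_positive_push)
  moreover have "design {p, q} (R @ push (1 / 460800) id (twin_cos p q))"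
    unfolding design_def using assms
    by (simp add: R_def sqnorm_on_def mass_twins second_moment_twins fourth_moment_twins inner_in_plane)
       (simp add: power2_eq_square power4_eq_xxxx field_simps)
  moreover have "snd ` set (twin_cos p q @ twin_sin p q) \<subseteq> snd ` set R"
    by (simp add: R_def image_Un snd_set_push) auto
  moreover have "(\<lambda>i. axis i 1) ` {p, q} \<subseteq> snd ` set R"
    by (auto simp: R_def image_Un in_plane_def)
  ultimately show ?thesis
    unfolding spare_twin_design_def by (intro exI [of _ R] exI [of _ "1 / 460800"]) auto
qed


text \<open>
  Induction over the coordinates, by suspension. The equator carries a positive multiple of the
  previous design and hence preserves the spare twin.
\<close>

lemma spare_twin_design_exists:
  assumes "p \<noteq> q" "finite T" "p \<notin> T" "q \<notin> T"
  shows "\<exists>R \<epsilon>. spare_twin_design p q ({p, q} \<union> T) R \<epsilon>"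
  using \<open>finite T\<close> assms(3,4)
proof (induction T rule: finite_induct)
  case empty
  then show ?case using spare_twin_design_in_plane [OF \<open>p \<noteq> q\<close>] by simp
next
  case (insert z T)
  define S where "S = {p, q} \<union> T"
  have S: "finite S" "z \<notin> S" "S \<noteq> {}"
    using insert by (auto simp: S_def)
  have "card {p, q} \<le> card S"
    using S by (intro card_mono) (auto simp: S_def)
  then have card: "real (card S) \<ge> 2" using \<open>p \<noteq> q\<close> by simp
  from insert obtain R \<epsilon> where R: "spare_twin_design p q S R \<epsilon>" by (auto simp: S_def)
  obtain p0 p1 w s c where w: "p0 > 0" "p1 > 0" "w > 0" "s \<in> \<rat>" "c \<in> \<rat>"
    "suspension_weights (real (card S)) p0 p1 w s c"
    using suspension_weights_exist [OF card] by metis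
  let ?D = "R @ push \<epsilon> id (twin_cos p q)"
  define R' where "R' = push p0 id R @ (p1, axis z 1) # layer w s c z ?D"
  have "design (insert z S) (push p0 id ?D @ (p1, axis z 1) # layer w s c z ?D)"
    using R S w by (intro design_suspension) (auto simp: spare_twin_design_def)
  then have "design (insert z S) (R' @ push (p0 * \<epsilon>) id (twin_cos p q))"
    by (rule design_cong) (simp_all add: R'_def algebra_simps)
  moreover have "p0 * \<epsilon> > 0"
    using R w by (simp add: spare_twin_design_def)
  moreover have "rational_positive R'"
    using R w unfolding R'_def spare_twin_design_def
    by (auto intro!: rational_positive_push rational_positive_layer simp: axis_def rational_positive_twins)
  moreover have "snd ` set (twin_cos p q @ twin_sin p q) \<subseteq> snd ` set R'"
      "(\<lambda>i. axis i 1) ` insert z S \<subseteq> snd ` set R'"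
  proof -
    have "snd ` set R \<subseteq> snd ` set R'"
      by (auto simp: R'_def image_Un snd_set_push)
    moreover have "axis z 1 \<in> snd ` set R'"
      by (simp add: R'_def)
    moreover have "snd ` set (twin_cos p q @ twin_sin p q) \<subseteq> snd ` set R"
      "(\<lambda>i. axis i 1) ` S \<subseteq> snd ` set R"
      using R unfolding spare_twin_design_def by blast+
    ultimately show "snd ` set (twin_cos p q @ twin_sin p q) \<subseteq> snd ` set R'"
      "(\<lambda>i. axis i 1) ` insert z S \<subseteq> snd ` set R'"
      by blast+
  qed
  ultimately have "spare_twin_design p q (insert z S) R' (p0 * \<epsilon>)"
    unfolding spare_twin_design_def by blast
  then show ?case unfolding S_def by auto
qed

lemma common_denominator:
  assumes "finite A" "A \<subseteq> \<rat>"
  shows "\<exists>Q::int. Q > 0 \<and> (\<forall>x\<in>A. \<exists>k::int. of_int Q * (x::real) = of_int k)"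
  using assms
proof (induction A rule: finite_induct)
  case empty
  then show ?case by (intro exI [of _ 1]) simp
next
  case (insert x A)
  then obtain Q :: int where Q: "Q > 0" "\<forall>x\<in>A. \<exists>k::int. of_int Q * x = of_int k" by auto
  obtain a b :: int where ab: "b > 0" "x = of_int a / of_int b"
    using insert.prems by (auto elim!: Rats_cases')
  show ?case
  proof (rule exI [of _ "b * Q"], intro conjI ballI)
    show "b * Q > 0" using ab Q by simp
    fix y assume "y \<in> insert x A"
    then consider "y = x" | k :: int where "of_int Q * y = of_int k" using Q by blast
    then show "\<exists>k::int. of_int (b * Q) * y = of_int k"
    proof cases
      case 1
      then show ?thesis using ab by (intro exI [of _ "a * Q"]) simp
    next
      case 2
      then show ?thesis by (intro exI [of _ "b * k"]) simp
    qed
  qed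
qed

lemma common_denominator_vectors:
  fixes R :: "(real \<times> (real ^ 'n)) list"
  assumes "rational_positive R"
  obtains Q :: int where "Q > 0" "\<And>u i. u \<in> snd ` set R \<Longrightarrow> \<exists>k::int. of_int Q * u $ i = of_int k"
proof -
  define A where "A = (\<Union>u\<in>snd ` set R. range (($) u))"
  have "finite A" "A \<subseteq> \<rat>"
    using assms by (auto simp: A_def rational_positive_def)
  from common_denominator [OF this] obtain Q :: int
    where "Q > 0" "\<forall>x\<in>A. \<exists>k::int. of_int Q * x = of_int k"
    by blast
  then show ?thesis by (intro that [of Q]) (auto simp: A_def)
qed

text \<open>
  At the displacement \<open>13 \<pi>\<close> along the first axis the phases of the first twin are \<open>13 \<pi>\<close>, \<open>0\<close>, \<open>39 \<pi>/5\<close>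
  and \<open>52 \<pi>/5\<close>, those of the second are \<open>5 \<pi>\<close> and \<open>12 \<pi>\<close>. The second sum vanishes, and so does the part
  of the first one that comes from the coordinate vectors; the other cosines in the first sum are
  positive.
\<close>

lemma twins_distinguished:
  assumes "r \<noteq> 0" "p \<noteq> q"
  shows "wsum (twin_cos p q) (\<lambda>u. cos (r *\<^sub>R u \<bullet> (13 * pi / r) *\<^sub>R axis p 1)) >
         wsum (twin_sin p q) (\<lambda>u. cos (r *\<^sub>R u \<bullet> (13 * pi / r) *\<^sub>R axis p 1))"
proof -
  have in1: "r *\<^sub>R in_plane p q x y \<bullet> (13 * pi / r) *\<^sub>R axis p 1 = 13 * pi * x" for x y
    using assms by (simp add: inner_in_plane) (simp add: axis_def)
  have per: "cos (t + 2 * pi * of_int k) = cos t" for t :: real and k :: int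
    using sin_cos_eq_iff by blast
  have 1: "cos (13 * pi * 1) = - 1"
    using per [of pi 6] by (simp add: algebra_simps)
  have 2: "cos (13 * pi * (3 / 5)) = cos (pi / 5)"
    using per [of "- (pi / 5)" 4] by (simp add: field_simps)
  have 3: "cos (13 * pi * (4 / 5)) = cos (2 * pi / 5)"
    using per [of "2 * pi / 5" 5] by (simp add: field_simps)
  have 4: "cos (13 * pi * (5 / 13)) = - 1"
    using per [of pi 2] by (simp add: algebra_simps)
  have 5: "cos (13 * pi * (12 / 13)) = 1"
    using per [of 0 6] by (simp add: algebra_simps)
  have "cos (pi / 5) > 0" "cos (2 * pi / 5) > 0"
    by (rule cos_gt_zero; simp)+
  then show ?thesis
    unfolding twin_cos_def twin_sin_def wsum_Cons wsum_Nil in1 1 2 3 4 5 by simp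
qed

section \<open>A non-equivariant torus\<close>

lemma sqnorm_on_UNIV: "sqnorm_on UNIV v = v \<bullet> v"
  by (simp add: sqnorm_on_def inner_vec_def power2_eq_square)

theorem proposition5p3:
  assumes "CARD('n::finite) \<ge> 3"
  shows "\<exists>(N::nat) (\<Lambda> :: (real ^ 'n) set) (f :: real ^ 'n \<Rightarrow> nat \<Rightarrow> real).
           N \<ge> 1 \<and>
           full_lattice \<Lambda> \<and>
           smooth_torus_embedding N \<Lambda> f \<and>
           range f \<subseteq> topspace (nsphere (N - 1)) \<and>
           flat_isometric N f \<and>
           normal_curvatures_at_most N f
             (sqrt (3 * real CARD('n) / (real CARD('n) + 2))) \<and>
           \<not> equivariant N \<Lambda> f"
proof -
  \<comment> \<open>The twins live in the plane of \<open>p\<close> and \<open>q\<close>, orthogonal to the modulating frequency along \<open>z\<close>.\<close>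
  obtain p q z :: 'n where pqz: "p \<noteq> q" "p \<noteq> z" "q \<noteq> z"
  proof -
    obtain T :: "'n set" where "card T = 3"
      using obtain_subset_with_card_n [OF assms] by blast
    then show ?thesis using that by (auto simp: card_3_iff)
  qed
  define n where "n = real CARD('n)"
  have n: "n \<ge> 3" using assms by (simp add: n_def)
  define S where "S = UNIV - {z}"
  have S: "insert z S = UNIV" "z \<notin> S" "S \<noteq> {}" "finite S"
    using pqz by (auto simp: S_def)
  have card_S: "real (card S) = n - 1"
    using n by (simp add: S_def n_def card_Diff_singleton of_nat_diff)
  have "{p, q} \<union> (S - {p, q}) = S" using pqz by (auto simp: S_def)
  then obtain R \<epsilon> where "spare_twin_design p q S R \<epsilon>"
    using spare_twin_design_exists [OF pqz(1), of "S - {p, q}"] by auto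
  then have \<epsilon>: "\<epsilon> > 0" and R: "rational_positive R"
    and des: "design S (R @ push \<epsilon> id (twin_cos p q))"
    and twins: "snd ` set (twin_cos p q @ twin_sin p q) \<subseteq> snd ` set R"
    and axes: "(\<lambda>i. axis i 1) ` S \<subseteq> snd ` set R"
    unfolding spare_twin_design_def by blast+
  have "real (card S) \<ge> 2" using card_S n by simp
  then obtain p0 p1 w s c where w: "p0 > 0" "p1 > 0" "w > 0" "s > 0" "c > 0" "s \<in> \<rat>" "c \<in> \<rat>"
    "suspension_weights (real (card S)) p0 p1 w s c"
    using suspension_weights_exist by metis
  \<comment> \<open>The design of the last suspension without the layer of the spare twin, which is the part of
    the spectrum that gets modulated.\<close>
  define D where "D = push p0 id R @ push (p0 * \<epsilon>) id (twin_cos p q) @ (p1, axis z 1) # layer w s c z R"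
  have D: "rational_positive D"
    using R w \<epsilon> unfolding D_def
    by (auto intro!: rational_positive_push rational_positive_layer simp: axis_def rational_positive_twins)
  have "design (insert z S) (push p0 id (R @ push \<epsilon> id (twin_cos p q)) @ (p1, axis z 1) #
      layer w s c z (R @ push \<epsilon> id (twin_cos p q)))"
    using des S(4,3,2) w(8) by (rule design_suspension)
  then have des': "design UNIV (D @ layer (w * \<epsilon>) s c z (twin_cos p q))"
    unfolding S by (rule design_cong) (simp_all add: D_def algebra_simps)
  have moments: "mass D + w * \<epsilon> * mass (twin_cos p q) = 1"
    "wsum D (\<lambda>u. (u \<bullet> v)\<^sup>2) + w * \<epsilon> * (s\<^sup>2 * wsum (twin_cos p q) (\<lambda>u. (u \<bullet> v)\<^sup>2) +
       c\<^sup>2 * (v $ z)\<^sup>2 * mass (twin_cos p q)) = (v \<bullet> v) / n"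
    "wsum D (\<lambda>u. (u \<bullet> v) ^ 4) + w * \<epsilon> * (s ^ 4 * wsum (twin_cos p q) (\<lambda>u. (u \<bullet> v) ^ 4) +
       6 * s\<^sup>2 * c\<^sup>2 * (v $ z)\<^sup>2 * wsum (twin_cos p q) (\<lambda>u. (u \<bullet> v)\<^sup>2) +
       c ^ 4 * (v $ z) ^ 4 * mass (twin_cos p q)) = 3 * (v \<bullet> v)\<^sup>2 / (n * (n + 2))" for v
    using des' unfolding design_def sqnorm_on_UNIV n_def [symmetric]
    by (simp_all add: second_moment_layer fourth_moment_layer)
  \<comment> \<open>Frequencies of length \<open>\<surd>n\<close> turn the second moments \<open>1/n\<close> of a design into the flat metric.\<close>
  define \<kappa> where "\<kappa> = sqrt n"
  have \<kappa>: "\<kappa> > 0" "\<kappa>\<^sup>2 = n" "\<kappa> ^ 4 = n\<^sup>2"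
    using n by (simp_all add: \<kappa>_def power4_eq_xxxx power2_eq_square)
  define L where "L = push 1 (\<lambda>u. \<kappa> *\<^sub>R u) D"
  define K where "K = push (w * \<epsilon>) (\<lambda>u. (\<kappa> * s) *\<^sub>R u) (twin_cos p q)"
  define M where "M = push (w * \<epsilon>) (\<lambda>u. (\<kappa> * s) *\<^sub>R u) (twin_sin p q)"
  define m where "m = (\<kappa> * c) *\<^sub>R axis z (1::real)"
  obtain Q :: int where Q: "Q > 0" "\<And>u i. u \<in> snd ` set D \<Longrightarrow> \<exists>k::int. of_int Q * u $ i = of_int k"
    using common_denominator_vectors [OF D] by blast
  have weights: "a > 0" if "(a, u) \<in> set L \<union> set K \<union> set M" for a u
    using that D w \<epsilon> rational_positive_twins [of p q]
    by (auto simp: L_def K_def M_def set_push rational_positive_def)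
  have freqs: "(\<exists>a. (a, u) \<in> set L) \<longleftrightarrow> u \<in> (*\<^sub>R) \<kappa> ` snd ` set D" for u
    unfolding L_def set_push by force
  interpret commensurable_spectrum L K M m "3 * n / (n + 2)" \<kappa> Q
  proof
    show "a > 0" if "(a, u) \<in> set L" for a u using weights that by blast
    show "a \<ge> 0" if "(a, u) \<in> set K" for a u using weights [of a u] that by simp
    show "a \<ge> 0" if "(a, u) \<in> set M" for a u using weights [of a u] that by simp
    show "mass M = mass K" by (simp add: K_def M_def mass_twins)
    show "wsum M (\<lambda>u. (u \<bullet> v)\<^sup>2) = wsum K (\<lambda>u. (u \<bullet> v)\<^sup>2)" for v
      by (simp add: K_def M_def wsum_push power_mult_distrib wsum_cmult second_moment_twins)
    show "wsum M (\<lambda>u. (u \<bullet> v) ^ 4) = wsum K (\<lambda>u. (u \<bullet> v) ^ 4)" for v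
      by (simp add: K_def M_def wsum_push power_mult_distrib wsum_cmult fourth_moment_twins)
    show "mass L + mass K = 1"
      using moments(1) by (simp add: L_def K_def)
    have mv: "m \<bullet> v = \<kappa> * c * v $ z" for v
      by (simp add: m_def inner_axis')
    show "wsum L (\<lambda>u. (u \<bullet> v)\<^sup>2) + (m \<bullet> v)\<^sup>2 * mass K + wsum K (\<lambda>u. (u \<bullet> v)\<^sup>2) = v \<bullet> v" for v
    proof -
      have "wsum L (\<lambda>u. (u \<bullet> v)\<^sup>2) + (m \<bullet> v)\<^sup>2 * mass K + wsum K (\<lambda>u. (u \<bullet> v)\<^sup>2) =
          \<kappa>\<^sup>2 * (wsum D (\<lambda>u. (u \<bullet> v)\<^sup>2) + w * \<epsilon> * (s\<^sup>2 * wsum (twin_cos p q) (\<lambda>u. (u \<bullet> v)\<^sup>2) +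
            c\<^sup>2 * (v $ z)\<^sup>2 * mass (twin_cos p q)))"
        by (simp add: L_def K_def mv wsum_push power_mult_distrib wsum_cmult algebra_simps)
      then show ?thesis using moments(2) [of v] \<kappa>(2) n by simp
    qed
    show "wsum L (\<lambda>u. (u \<bullet> v) ^ 4) + (m \<bullet> v) ^ 4 * mass K +
        6 * (m \<bullet> v)\<^sup>2 * wsum K (\<lambda>u. (u \<bullet> v)\<^sup>2) + wsum K (\<lambda>u. (u \<bullet> v) ^ 4) =
        3 * n / (n + 2) * (v \<bullet> v)\<^sup>2" for v
    proof -
      have "wsum L (\<lambda>u. (u \<bullet> v) ^ 4) + (m \<bullet> v) ^ 4 * mass K +
          6 * (m \<bullet> v)\<^sup>2 * wsum K (\<lambda>u. (u \<bullet> v)\<^sup>2) + wsum K (\<lambda>u. (u \<bullet> v) ^ 4) =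
          \<kappa> ^ 4 * (wsum D (\<lambda>u. (u \<bullet> v) ^ 4) + w * \<epsilon> * (s ^ 4 * wsum (twin_cos p q) (\<lambda>u. (u \<bullet> v) ^ 4) +
            6 * s\<^sup>2 * c\<^sup>2 * (v $ z)\<^sup>2 * wsum (twin_cos p q) (\<lambda>u. (u \<bullet> v)\<^sup>2) +
            c ^ 4 * (v $ z) ^ 4 * mass (twin_cos p q)))"
      proof -
        have "\<kappa> ^ 4 = \<kappa>\<^sup>2 * \<kappa>\<^sup>2" by (simp add: power2_eq_square power4_eq_xxxx)
        then show ?thesis
          by (simp add: L_def K_def mv wsum_push power_mult_distrib wsum_cmult algebra_simps)
      qed
      also have "\<dots> = n\<^sup>2 * (3 * (v \<bullet> v)\<^sup>2 / (n * (n + 2)))"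
        unfolding moments(3) \<kappa>(3) ..
      also have "\<dots> = 3 * n / (n + 2) * (v \<bullet> v)\<^sup>2"
        using n by (simp add: power2_eq_square)
      finally show ?thesis .
    qed
    show "\<kappa> > 0" "Q > 0" by fact+
    show "\<exists>a. (a, axis i \<kappa>) \<in> set L" for i
    proof -
      have "axis i 1 \<in> snd ` set D"
        using axes S by (cases "i = z") (auto simp: D_def image_Un snd_set_push)
      moreover have "axis i \<kappa> = \<kappa> *\<^sub>R axis i 1" by (simp add: axis_def vec_eq_iff)
      ultimately show ?thesis unfolding freqs by blast
    qed
    show "\<exists>k::int. of_int Q * u $ i = \<kappa> * of_int k" if au: "(a, u) \<in> set L" for a u i
    proof -
      obtain u' where u': "u = \<kappa> *\<^sub>R u'" "u' \<in> snd ` set D"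
        using au freqs [of u] by blast
      then obtain k :: int where "of_int Q * u' $ i = of_int k" using Q by blast
      then show ?thesis using u' by (intro exI [of _ k]) (simp add: algebra_simps)
    qed
    show "(\<exists>a. (a, u + m) \<in> set L) \<and> (\<exists>a. (a, u - m) \<in> set L)" if au: "(a, u) \<in> set K \<union> set M" for a u
    proof -
      obtain u' where u': "u = (\<kappa> * s) *\<^sub>R u'" "u' \<in> snd ` set R"
        using au twins by (force simp: K_def M_def set_push)
      have "u + m = \<kappa> *\<^sub>R (s *\<^sub>R u' + c *\<^sub>R axis z 1)" "u - m = \<kappa> *\<^sub>R (s *\<^sub>R u' - c *\<^sub>R axis z 1)"
        by (simp_all add: u' m_def algebra_simps)
      moreover have "s *\<^sub>R u' + c *\<^sub>R axis z 1 \<in> snd ` set D" "s *\<^sub>R u' - c *\<^sub>R axis z 1 \<in> snd ` set D"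
        using u' by (auto simp: D_def image_Un snd_set_layer)
      ultimately show ?thesis unfolding freqs by blast
    qed
  qed
  have "\<not> equivariant (length waves) periods torus"
  proof (rule torus_not_equivariant)
    let ?h = "(13 * pi / (\<kappa> * s)) *\<^sub>R axis p 1 :: real ^ 'n"
    have "m $ z \<noteq> 0" using \<kappa> w by (simp add: m_def)
    then show "m \<noteq> 0" by auto
    show "m \<bullet> ?h = 0" using pqz by (simp add: m_def inner_axis_axis)
    have "\<kappa> * s \<noteq> 0" using \<kappa> w by simp
    from twins_distinguished [OF this pqz(1)] w \<epsilon>
    show "wsum K (\<lambda>u. cos (u \<bullet> ?h)) \<noteq> wsum M (\<lambda>u. cos (u \<bullet> ?h))"
      by (simp add: K_def M_def wsum_push)
  qed
  then show ?thesis
    using torus_nonempty full_lattice_periods torus_embedding torus_in_sphere torus_flat torus_curvature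
    unfolding n_def by (intro exI [of _ "length waves"] exI [of _ periods] exI [of _ torus]) simp
qed

end
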